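(* Let $G$ be a finite group with supercharacter theory $S$, and suppose $G$ is not $S$-abelian. The following are equivalent: (1) $G$ is a $VZ(S)$-group. (2) $Z(S)=V(S)$. (3) $U(S)=[G,S]$.
   Context: $\mathrm{Irr}(G)$ is the set of complex irreducible characters of the finite group $G$. A supercharacter theory $S$ of $G$ is a pair $(\mathcal X,\mathcal Y)$, where $\mathcal X$ is a partition of $\mathrm{Irr}(G)$ and $\mathcal Y$ is a partition of $G$, such that $\{1\}\in\mathcal Y$, $|\mathcal X|=|\mathcal Y|$, and for each $X\in\mathcal X$ the character $\sigma_X=\sum_{\chi\in X}\chi(1)\chi$ is constant on each $Y\in\mathcal Y$. The parts $Y\in\mathcal Y$ are the $S$-classes, $\mathrm{Cl}_S(g)$ is the $S$-class containing $g$, the characters $\sigma_X$ are the $S$-characters, and $\mathrm{Irr}(S)=\{\sigma_X: X\in\mathcal X\}$. For a character $\chi$, $\ker(\chi)=\{g\in G:\chi(g)=\chi(1)\}$. A subgroup $N\le G$ is $S$-normal if it is a union of $S$-classes. $Z(S)=\{g\in G: |\mathrm{Cl}_S(g)|=1\}$, and $G$ is $S$-abelian if $Z(S)=G$. $[G,S]=\langle g^{-1}k: g\in G,\ k\in \mathrm{Cl}_S(g)\rangle$. The subgroups $Z(S)$ and $[G,S]$ are $S$-normal. For $N$ $S$-normal, $\mathrm{Irr}(S\mid N)$ is the set of $\chi\in\mathrm{Irr}(S)$ with $N\not\le\ker(\chi)$; $V(S\mid N)=\langle g\in G: \text{there exists }\chi\in\mathrm{Irr}(S\mid N)\text{ with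 }\chi(g)\ne0\rangle$; and $U(S\mid N)$ is the product of all $S$-normal subgroups $H$ of $G$ such that $V(S\mid H)\le N$. Set $V(S)=V(S\mid[G,S])$ and $U(S)=U(S\mid Z(S))$. $G$ is a $VZ(S)$-group if every $\chi\in\mathrm{Irr}(S\mid[G,S])$ vanishes on $G\setminus Z(S)$. *)

theory Defs
  imports
    "HOL-Algebra.Generated_Groups"
    "HOL-Library.Disjoint_Sets"
    "HOL-Library.FuncSet"
    "Jordan_Normal_Form.VS_Connect"
begin

section \<open>Complex irreducible characters\<close>

definition GL :: "nat \<Rightarrow> complex mat monoid" where
  "GL n = units_of (ring_mat TYPE(complex) n ())"

definition irreducible_rep :: "('a, 'b) monoid_scheme \<Rightarrow> nat \<Rightarrow> ('a \<Rightarrow> complex mat) \<Rightarrow> bool" where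
  "irreducible_rep G n \<rho> \<longleftrightarrow>
     \<rho> \<in> hom G (GL n) \<and> n \<noteq> 0 \<and>
     (\<forall>W. VectorSpace.subspace class_ring W (module_vec TYPE(complex) n) \<and>
          (\<forall>g\<in>carrier G. \<forall>w\<in>W. \<rho> g *\<^sub>v w \<in> W)
        \<longrightarrow> W = {0\<^sub>v n} \<or> W = carrier_vec n)"

definition mat_trace :: "complex mat \<Rightarrow> complex" where
  "mat_trace A = (\<Sum>i<dim_row A. A $$ (i, i))"

text \<open>Characters are extensional (\<open>undefined\<close> off the carrier), so that characters
  agreeing on \<open>G\<close> are equal as elements of \<open>Irr G\<close>.\<close>

definition character_of :: "('a, 'b) monoid_scheme \<Rightarrow> ('a \<Rightarrow> complex mat) \<Rightarrow> 'a \<Rightarrow> complex" where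
  "character_of G \<rho> = (\<lambda>g\<in>carrier G. mat_trace (\<rho> g))"

definition Irr :: "('a, 'b) monoid_scheme \<Rightarrow> ('a \<Rightarrow> complex) set" where
  "Irr G = {character_of G \<rho> | \<rho> n. irreducible_rep G n \<rho>}"

definition char_ker :: "('a, 'b) monoid_scheme \<Rightarrow> ('a \<Rightarrow> complex) \<Rightarrow> 'a set" where
  "char_ker G \<chi> = {g \<in> carrier G. \<chi> g = \<chi> \<one>\<^bsub>G\<^esub>}"


section \<open>Supercharacter theories\<close>

type_synonym 'a sct = "('a \<Rightarrow> complex) set set \<times> 'a set set"

definition sigma_char ::
    "('a, 'b) monoid_scheme \<Rightarrow> ('a \<Rightarrow> complex) set \<Rightarrow> 'a \<Rightarrow> complex" where
  "sigma_char G X = (\<lambda>g\<in>carrier G. \<Sum>\<chi>\<in>X. \<chi> \<one>\<^bsub>G\<^esub> * \<chi> g)"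

definition supercharacter_theory :: "('a, 'b) monoid_scheme \<Rightarrow> 'a sct \<Rightarrow> bool" where
  "supercharacter_theory G S \<longleftrightarrow>
     partition_on (Irr G) (fst S) \<and>
     partition_on (carrier G) (snd S) \<and>
     {\<one>\<^bsub>G\<^esub>} \<in> snd S \<and>
     card (fst S) = card (snd S) \<and>
     (\<forall>X\<in>fst S. \<forall>Y\<in>snd S. \<forall>g\<in>Y. \<forall>h\<in>Y. sigma_char G X g = sigma_char G X h)"

definition S_class :: "'a sct \<Rightarrow> 'a \<Rightarrow> 'a set" where
  "S_class S g = (THE Y. Y \<in> snd S \<and> g \<in> Y)"

definition S_irr :: "('a, 'b) monoid_scheme \<Rightarrow> 'a sct \<Rightarrow> ('a \<Rightarrow> complex) set" where
  "S_irr G S = sigma_char G ` fst S"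

definition S_normal :: "('a, 'b) monoid_scheme \<Rightarrow> 'a sct \<Rightarrow> 'a set \<Rightarrow> bool" where
  "S_normal G S N \<longleftrightarrow> subgroup N G \<and> (\<exists>C. C \<subseteq> snd S \<and> N = \<Union>C)"

definition S_center :: "('a, 'b) monoid_scheme \<Rightarrow> 'a sct \<Rightarrow> 'a set" where
  "S_center G S = {g \<in> carrier G. card (S_class S g) = 1}"

definition S_abelian :: "('a, 'b) monoid_scheme \<Rightarrow> 'a sct \<Rightarrow> bool" where
  "S_abelian G S \<longleftrightarrow> S_center G S = carrier G"

definition S_commutator :: "('a, 'b) monoid_scheme \<Rightarrow> 'a sct \<Rightarrow> 'a set" where
  "S_commutator G S =
     generate G {inv\<^bsub>G\<^esub> g \<otimes>\<^bsub>G\<^esub> k | g k. g \<in> carrier G \<and> k \<in> S_class S g}"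

definition S_irr_over ::
    "('a, 'b) monoid_scheme \<Rightarrow> 'a sct \<Rightarrow> 'a set \<Rightarrow> ('a \<Rightarrow> complex) set" where
  "S_irr_over G S N = {\<chi> \<in> S_irr G S. \<not> N \<subseteq> char_ker G \<chi>}"

definition V_over :: "('a, 'b) monoid_scheme \<Rightarrow> 'a sct \<Rightarrow> 'a set \<Rightarrow> 'a set" where
  "V_over G S N = generate G {g \<in> carrier G. \<exists>\<chi>\<in>S_irr_over G S N. \<chi> g \<noteq> 0}"

text \<open>The product \<open>H\<^sub>1 H\<^sub>2 \<dots> H\<^sub>k\<close> of a finite family of subgroups, each taken once.
  When the subgroups are normal, as \<open>S\<close>-normal subgroups are, every ordering gives the
  same set; the union over all orderings avoids choosing one.\<close>

definition subgroups_product :: "('a, 'b) monoid_scheme \<Rightarrow> 'a set set \<Rightarrow> 'a set" where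
  "subgroups_product G \<H> =
     (\<Union>Hs\<in>{Hs. distinct Hs \<and> set Hs = \<H>}. foldr (set_mult G) Hs {\<one>\<^bsub>G\<^esub>})"

definition U_over :: "('a, 'b) monoid_scheme \<Rightarrow> 'a sct \<Rightarrow> 'a set \<Rightarrow> 'a set" where
  "U_over G S N = subgroups_product G {H. S_normal G S H \<and> V_over G S H \<subseteq> N}"

definition V_S :: "('a, 'b) monoid_scheme \<Rightarrow> 'a sct \<Rightarrow> 'a set" where
  "V_S G S = V_over G S (S_commutator G S)"

definition U_S :: "('a, 'b) monoid_scheme \<Rightarrow> 'a sct \<Rightarrow> 'a set" where
  "U_S G S = U_over G S (S_center G S)"

definition VZ_group :: "('a, 'b) monoid_scheme \<Rightarrow> 'a sct \<Rightarrow> bool" where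
  "VZ_group G S \<longleftrightarrow>
     (\<forall>\<chi>\<in>S_irr_over G S (S_commutator G S). \<forall>g\<in>carrier G - S_center G S. \<chi> g = 0)"

end

theory Submission
  imports Defs "Jordan_Normal_Form.Spectral_Radius" "HOL-Library.Function_Algebras"
begin

text \<open>Write \<open>\<sigma>\<^sub>X\<close> for the \<open>S\<close>-characters.  Everything rests on one dimension count.  By orthogonality of
irreducible characters the \<open>\<sigma>\<^sub>X\<close> are linearly independent; they are constant on the \<open>S\<close>-classes, and
there are as many of them as \<open>S\<close>-classes.  Hence every function that is constant on \<open>S\<close>-classes is a
combination of the \<open>\<sigma>\<^sub>X\<close>, and its coefficients can be read off by pairing it with any member of
\<open>X\<close> (\<open>superclass_expansion\<close>).  The following are obtained by choosing the function well.

\<^item> Indicators of \<open>S\<close>-classes are class functions, so an \<open>S\<close>-class is a union of conjugacy classes and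
  \<open>Z(S)\<close> is central in \<open>G\<close>.
\<^item> Expanding the point mass at \<open>z \<in> Z(S)\<close> shows that \<open>z\<close> acts by the same non-zero scalar in all
  representations belonging to one \<open>X\<close>.  So translation by \<open>z\<close> only rescales each \<open>\<sigma>\<^sub>X\<close>; it follows that
  \<open>Z(S)\<close> is a subgroup and that no \<open>\<sigma>\<^sub>X\<close> vanishes at a point of \<open>Z(S)\<close>.
\<^item> Expanding the indicator of an \<open>S\<close>-normal subgroup \<open>N\<close> shows that \<open>N\<close> is the intersection of the
  kernels of the \<open>\<sigma>\<^sub>X\<close> that contain it (\<open>S_normal_separation\<close>).
\<^item> If \<open>[G,S]\<close> lies in the kernel of \<open>\<sigma>\<^sub>X\<close>, then each \<open>\<chi> \<in> X\<close> is itself constant on \<open>S\<close>-classes, and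
  expanding \<open>\<chi>\<close> forces \<open>X = {\<chi>}\<close>.  Moreover every group element acts by a scalar, so \<open>\<sigma>\<^sub>X\<close> vanishes
  nowhere (\<open>sigma_nonvanishing\<close>).\<close>

text \<open>As \<open>Z(S)\<close> is a subgroup, \<open>V(S | N) \<le> Z(S)\<close> says that each member of \<open>Irr(S | N)\<close> vanishes off \<open>Z(S)\<close>.
For \<open>N = [G,S]\<close> this is the definition of a \<open>VZ(S)\<close>-group.  When \<open>G\<close> is not \<open>S\<close>-abelian, some \<open>\<sigma>\<^sub>X\<close> lies
over \<open>[G,S] \<noteq> 1\<close>, and being non-zero on \<open>Z(S)\<close> it gives \<open>Z(S) \<le> V(S)\<close>; so the first two conditions are equivalent.

For the third, suppose that \<open>H\<close> is \<open>S\<close>-normal with \<open>V(S | H) \<le> Z(S)\<close> but \<open>H\<close> is not inside \<open>[G,S]\<close>.  Separation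
provides a \<open>\<sigma>\<^sub>X\<close> over \<open>H\<close> with \<open>[G,S]\<close> in its kernel; it vanishes nowhere, whence \<open>Z(S) = G\<close>, which is
excluded.  Thus \<open>U(S) \<le> [G,S]\<close> always holds.  If \<open>V(S) \<le> Z(S)\<close>, then \<open>[G,S]\<close> is itself one of the factors of
\<open>U(S)\<close>, and equality follows.  Conversely, if \<open>U(S) = [G,S]\<close>, a \<open>\<sigma>\<^sub>X\<close> over \<open>[G,S]\<close> is over one of the factors \<open>H\<close>,
since kernels absorb products of normal subgroups; hence it vanishes off \<open>Z(S)\<close>.\<close>


section \<open>Intertwiners of irreducible representations\<close>

lemma subspace_module_vecI:
  fixes W :: "complex vec set"
  assumes "W \<subseteq> carrier_vec n" "0\<^sub>v n \<in> W"
    and "\<And>v w. v \<in> W \<Longrightarrow> w \<in> W \<Longrightarrow> v + w \<in> W"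
    and "\<And>c v. v \<in> W \<Longrightarrow> c \<cdot>\<^sub>v v \<in> W"
  shows "VectorSpace.subspace class_ring W (module_vec TYPE(complex) n)"
proof -
  have vs: "vectorspace (class_ring :: complex ring) (module_vec TYPE(complex) n)"
    by (rule vec_vs)
  have md: "Module.module (class_ring :: complex ring) (module_vec TYPE(complex) n)"
    by (rule vec_module)
  show ?thesis
    unfolding VectorSpace.subspace_def submodule_def
    using vs md assms by (auto simp: module_vec_simps)
qed

lemma mat_trace_mult_comm:
  assumes A: "A \<in> carrier_mat n m" and B: "B \<in> carrier_mat m n"
  shows "mat_trace (A * B) = mat_trace (B * A)"
proof -
  have "mat_trace (A * B) = (\<Sum>i<n. \<Sum>j<m. A $$ (i, j) * B $$ (j, i))"
    using A B by (auto simp: mat_trace_def scalar_prod_def atLeast0LessThan intro!: sum.cong)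
  also have "\<dots> = (\<Sum>j<m. \<Sum>i<n. B $$ (j, i) * A $$ (i, j))"
    by (subst sum.swap) (simp add: mult.commute)
  also have "\<dots> = mat_trace (B * A)"
    using A B by (auto simp: mat_trace_def scalar_prod_def atLeast0LessThan intro!: sum.cong)
  finally show ?thesis .
qed

lemma mat_eq_0I:
  fixes A :: "complex mat"
  assumes A: "A \<in> carrier_mat n m"
    and z: "\<And>v. v \<in> carrier_vec m \<Longrightarrow> A *\<^sub>v v = 0\<^sub>v n"
  shows "A = 0\<^sub>m n m"
proof (rule eq_matI)
  fix i j assume "i < dim_row (0\<^sub>m n m :: complex mat)" "j < dim_col (0\<^sub>m n m :: complex mat)"
  then have ij: "i < n" "j < m" by auto
  have "A $$ (i, j) = (A *\<^sub>v unit_vec m j) $ i"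
    using A ij by simp
  then show "A $$ (i, j) = 0\<^sub>m n m $$ (i, j)" using z[of "unit_vec m j"] ij by simp
qed (use A in auto)

lemma mult_mat_zero_vec:
  fixes A :: "complex mat"
  assumes "A \<in> carrier_mat n m"
  shows "A *\<^sub>v 0\<^sub>v m = 0\<^sub>v n"
  using assms by (intro eq_vecI) auto

locale finite_group = group G for G (structure) +
  assumes finite_carrier [simp, intro]: "finite (carrier G)"
begin

context
  fixes n :: nat and \<rho> :: "'a \<Rightarrow> complex mat"
  assumes irr: "irreducible_rep G n \<rho>"
begin

lemma rep_carrier [simp]: "g \<in> carrier G \<Longrightarrow> \<rho> g \<in> carrier_mat n n"
  using irr by (auto simp: irreducible_rep_def GL_def hom_def units_of_def ring_mat_def Units_def Pi_def)

lemma rep_dim [simp]: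
  "g \<in> carrier G \<Longrightarrow> dim_row (\<rho> g) = n" "g \<in> carrier G \<Longrightarrow> dim_col (\<rho> g) = n"
  using carrier_matD[OF rep_carrier] by blast+

lemma rep_dim_pos: "n > 0"
  using irr by (simp add: irreducible_rep_def)

lemma rep_mult: "g \<in> carrier G \<Longrightarrow> h \<in> carrier G \<Longrightarrow> \<rho> (g \<otimes> h) = \<rho> g * \<rho> h"
  using irr by (auto simp: irreducible_rep_def GL_def hom_def units_of_def ring_mat_def)

lemma rep_one: "\<rho> \<one> = 1\<^sub>m n"
proof -
  interpret R: ring "ring_mat TYPE(complex) n ()" by (rule ring_mat)
  have GL: "group (GL n)" unfolding GL_def by (rule R.units_group)
  have "\<rho> \<in> hom G (GL n)" using irr by (simp add: irreducible_rep_def)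
  then have "\<rho> \<one> = \<one>\<^bsub>GL n\<^esub>" using hom_one GL is_group by blast
  then show ?thesis by (simp add: GL_def units_of_def ring_mat_def)
qed

lemma rep_r_inv: "g \<in> carrier G \<Longrightarrow> \<rho> g * \<rho> (inv g) = 1\<^sub>m n"
  using rep_mult[of g "inv g"] rep_one by simp

lemma rep_l_inv: "g \<in> carrier G \<Longrightarrow> \<rho> (inv g) * \<rho> g = 1\<^sub>m n"
  using rep_mult[of "inv g" g] rep_one by simp

lemma rep_irreducible:
  assumes "W \<subseteq> carrier_vec n" "0\<^sub>v n \<in> W"
    and "\<And>v w. v \<in> W \<Longrightarrow> w \<in> W \<Longrightarrow> v + w \<in> W"
    and "\<And>c v. v \<in> W \<Longrightarrow> c \<cdot>\<^sub>v v \<in> W"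
    and "\<And>g v. g \<in> carrier G \<Longrightarrow> v \<in> W \<Longrightarrow> \<rho> g *\<^sub>v v \<in> W"
  shows "W = {0\<^sub>v n} \<or> W = carrier_vec n"
  using irr subspace_module_vecI[OF assms(1-4)] assms(5) unfolding irreducible_rep_def by blast

end

text \<open>Schur's lemma.  The kernel and the image of an intertwiner are invariant, so a non-zero intertwiner is injective
and surjective.  The conclusion is a two-sided inverse rather than \<open>n = m\<close>: it is
all that comparing traces needs.\<close>

lemma Schur:
  assumes irr\<rho>: "irreducible_rep G n \<rho>" and irr\<tau>: "irreducible_rep G m \<tau>"
    and T: "T \<in> carrier_mat n m"
    and inter: "\<And>g. g \<in> carrier G \<Longrightarrow> \<rho> g * T = T * \<tau> g"
    and nz: "T \<noteq> 0\<^sub>m n m"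
  obtains U where "U \<in> carrier_mat m n" "T * U = 1\<^sub>m n" "U * T = 1\<^sub>m m"
proof -
  note [simp] = rep_carrier[OF irr\<rho>] rep_carrier[OF irr\<tau>]
  have act: "T *\<^sub>v (\<tau> g *\<^sub>v v) = \<rho> g *\<^sub>v (T *\<^sub>v v)" if "g \<in> carrier G" "v \<in> carrier_vec m" for g v
    using that T inter[OF that(1)]
    by (metis assoc_mult_mat_vec rep_carrier[OF irr\<rho>] rep_carrier[OF irr\<tau>])
  have ker: "v = 0\<^sub>v m" if "v \<in> carrier_vec m" "T *\<^sub>v v = 0\<^sub>v n" for v
  proof -
    let ?W = "{v \<in> carrier_vec m. T *\<^sub>v v = 0\<^sub>v n}"
    have "?W = {0\<^sub>v m} \<or> ?W = carrier_vec m"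
    proof (rule rep_irreducible[OF irr\<tau>])
      show "v + w \<in> ?W" if "v \<in> ?W" "w \<in> ?W" for v w
        using that T by (auto simp: mult_add_distrib_mat_vec[OF T])
      show "c \<cdot>\<^sub>v v \<in> ?W" if "v \<in> ?W" for c v
        using that T by (auto simp: mult_mat_vec[OF T])
      show "\<tau> g *\<^sub>v v \<in> ?W" if "g \<in> carrier G" "v \<in> ?W" for g v
        using that rep_carrier[OF irr\<tau>, of g] rep_carrier[OF irr\<rho>, of g]
        by (auto simp: act mult_mat_zero_vec intro!: mult_mat_vec_carrier[of _ m m])
    qed (use T in \<open>auto intro!: eq_vecI\<close>)
    moreover have "?W \<noteq> carrier_vec m"
      using mat_eq_0I[OF T] nz by blast
    ultimately show ?thesis using that by blast
  qed
  have im: "\<exists>v \<in> carrier_vec m. T *\<^sub>v v = w" if "w \<in> carrier_vec n" for w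
  proof -
    let ?W = "(\<lambda>v. T *\<^sub>v v) ` carrier_vec m"
    have "?W = {0\<^sub>v n} \<or> ?W = carrier_vec n"
    proof (rule rep_irreducible[OF irr\<rho>])
      show "?W \<subseteq> carrier_vec n" using T by auto
      show "0\<^sub>v n \<in> ?W" using T by (intro image_eqI[of _ _ "0\<^sub>v m"]) (auto intro!: eq_vecI)
      show "v + w \<in> ?W" if vw: "v \<in> ?W" "w \<in> ?W" for v w
      proof -
        obtain v' w' where "v' \<in> carrier_vec m" "w' \<in> carrier_vec m" "v = T *\<^sub>v v'" "w = T *\<^sub>v w'"
          using vw by blast
        then show ?thesis
          by (intro image_eqI[of _ _ "v' + w'"]) (auto simp: mult_add_distrib_mat_vec[OF T])
      qed
      show "c \<cdot>\<^sub>v v \<in> ?W" if v: "v \<in> ?W" for c v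
      proof -
        obtain v' where "v' \<in> carrier_vec m" "v = T *\<^sub>v v'" using v by blast
        then show ?thesis
          by (intro image_eqI[of _ _ "c \<cdot>\<^sub>v v'"]) (auto simp: mult_mat_vec[OF T])
      qed
      show "\<rho> g *\<^sub>v v \<in> ?W" if g: "g \<in> carrier G" and v: "v \<in> ?W" for g v
      proof -
        obtain v' where "v' \<in> carrier_vec m" "v = T *\<^sub>v v'" using v by blast
        then show ?thesis using g
          by (intro image_eqI[of _ _ "\<tau> g *\<^sub>v v'"]) (auto simp: act intro!: mult_mat_vec_carrier[of _ m m])
      qed
    qed
    moreover have "?W \<noteq> {0\<^sub>v n}"
      using mat_eq_0I[OF T] nz by blast
    ultimately have "w \<in> ?W" using that by auto
    then show ?thesis by blast
  qed
  then obtain u where u: "\<And>w. w \<in> carrier_vec n \<Longrightarrow> u w \<in> carrier_vec m \<and> T *\<^sub>v u w = w"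
    by metis
  (* The columns of the right inverse are preimages of the unit vectors. *)
  define U where "U = mat_of_cols m (map (\<lambda>j. u (unit_vec n j)) [0..<n])"
  have U: "U \<in> carrier_mat m n" by (auto simp: U_def)
  have TU: "T * U = 1\<^sub>m n"
  proof (rule mat_col_eqI)
    fix j assume "j < dim_col (1\<^sub>m n :: complex mat)"
    then have j: "j < n" by simp
    have "col U j = u (unit_vec n j)" using j u by (simp add: U_def)
    then show "col (T * U) j = col (1\<^sub>m n) j"
      using col_mult2[OF T U j] u j by simp
  qed (use T U in auto)
  (* T kills U T - 1 because T U = 1, and T is injective. *)
  have "U * T - 1\<^sub>m m = 0\<^sub>m m m"
  proof (rule mat_eq_0I)
    fix v :: "complex vec" assume v: "v \<in> carrier_vec m"
    have "T * (U * T - 1\<^sub>m m) = 0\<^sub>m n m"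
      using T U TU by (simp add: mult_minus_distrib_mat[of T n m "U * T" m "1\<^sub>m m"]
          assoc_mult_mat[of T n m U n T m, symmetric])
    moreover have M: "U * T - 1\<^sub>m m \<in> carrier_mat m m" using U T by auto
    ultimately have "T *\<^sub>v ((U * T - 1\<^sub>m m) *\<^sub>v v) = 0\<^sub>m n m *\<^sub>v v"
      using assoc_mult_mat_vec[OF T M v] by simp
    then have "T *\<^sub>v ((U * T - 1\<^sub>m m) *\<^sub>v v) = 0\<^sub>v n" using v by (auto intro!: eq_vecI)
    then show "(U * T - 1\<^sub>m m) *\<^sub>v v = 0\<^sub>v m"
      using U T v by (intro ker) (auto intro!: mult_mat_vec_carrier[of _ m m])
  qed (use U T in auto)
  then have "U * T = 1\<^sub>m m"
    using U T by (auto simp: mat_eq_iff)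
  with U TU that show ?thesis by blast
qed

text \<open>Subtract an eigenvalue: the difference commutes with the representation and is singular,
so it is zero by Schur's lemma.\<close>

lemma commuting_matrix_scalar:
  assumes irr: "irreducible_rep G n \<rho>" and A: "A \<in> carrier_mat n n"
    and comm: "\<And>g. g \<in> carrier G \<Longrightarrow> \<rho> g * A = A * \<rho> g"
  obtains c where "A = c \<cdot>\<^sub>m 1\<^sub>m n"
proof -
  obtain c v where v: "v \<in> carrier_vec n" "v \<noteq> 0\<^sub>v n" "A *\<^sub>v v = c \<cdot>\<^sub>v v"
    using spectrum_non_empty[OF A] rep_dim_pos[OF irr] A
    by (auto simp: spectrum_def eigenvalue_def eigenvector_def)
  define T where "T = A - c \<cdot>\<^sub>m 1\<^sub>m n"
  have T: "T \<in> carrier_mat n n" by (auto simp: T_def)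
  have Tv: "T *\<^sub>v v = 0\<^sub>v n"
    using A v by (auto simp: T_def minus_mult_distrib_mat_vec[of A n n])
  have "T = 0\<^sub>m n n"
  proof (rule ccontr)
    assume "T \<noteq> 0\<^sub>m n n"
    moreover have "\<rho> g * T = T * \<rho> g" if g: "g \<in> carrier G" for g
      using A comm[OF g] rep_carrier[OF irr g] unfolding T_def
      by (simp add: mult_minus_distrib_mat[of _ n n] minus_mult_distrib_mat[of _ n n]
         mult_smult_distrib[of _ n n _ n] mult_smult_assoc_mat[of _ n n])
    ultimately obtain U where U: "U \<in> carrier_mat n n" "U * T = 1\<^sub>m n"
      using Schur[OF irr irr T] by metis
    have "v = (U * T) *\<^sub>v v" using U v by simp
    also have "\<dots> = U *\<^sub>v (T *\<^sub>v v)" using U(1) T v(1) by (rule assoc_mult_mat_vec)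
    also have "\<dots> = 0\<^sub>v n" using U Tv by (auto intro!: eq_vecI)
    finally show False using v by simp
  qed
  then have "A = c \<cdot>\<^sub>m 1\<^sub>m n"
    using A by (auto simp: T_def mat_eq_iff)
  then show ?thesis using that by blast
qed

end


section \<open>Functions constant on the blocks of a partition\<close>

lemma sum_fun_apply: "(\<Sum>i\<in>I. f i) x = (\<Sum>i\<in>I. f i x)"
  by (induction I rule: infinite_finite_induct) auto

text \<open>Functions that admit a dual system \<open>h\<close> are linearly independent.  If moreover they are constant on the blocks of
a partition, they live in the space spanned by the indicators of the blocks, whose dimension is at most
the number of blocks: so there are finitely many of them, and if they are as many as the blocks they span that space.
The first part, for the partition into points, makes \<open>Irr(G)\<close> finite; the second is the
source of all expansions in terms of \<open>S\<close>-characters.\<close>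

lemma biorthogonal_span:
  fixes f h :: "'i \<Rightarrow> 'a \<Rightarrow> complex"
  assumes fin: "finite A" and part: "partition_on A Y"
    and const: "\<And>i B x y. i \<in> I \<Longrightarrow> B \<in> Y \<Longrightarrow> x \<in> B \<Longrightarrow> y \<in> B \<Longrightarrow> f i x = f i y"
    and off: "\<And>i j. i \<in> I \<Longrightarrow> j \<in> I \<Longrightarrow> i \<noteq> j \<Longrightarrow> (\<Sum>x\<in>A. f i x * h j x) = 0"
    and diag: "\<And>i. i \<in> I \<Longrightarrow> (\<Sum>x\<in>A. f i x * h i x) \<noteq> 0"
  shows "finite I"
    and "card I = card Y \<Longrightarrow> (\<And>B x y. B \<in> Y \<Longrightarrow> x \<in> B \<Longrightarrow> y \<in> B \<Longrightarrow> F x = F y) \<Longrightarrow>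
      \<exists>c. \<forall>x\<in>A. F x = (\<Sum>i\<in>I. c i * f i x)"
proof -
  interpret V: vector_space "\<lambda>(c::complex) (u::'a \<Rightarrow> complex) x. c * u x"
    by unfold_locales (auto simp: fun_eq_iff algebra_simps)
  (* Cutting off outside A makes functions that agree on A equal as vectors. *)
  define res :: "('a \<Rightarrow> complex) \<Rightarrow> 'a \<Rightarrow> complex" where "res u = (\<lambda>x. if x \<in> A then u x else 0)" for u
  define ind :: "'a set \<Rightarrow> 'a \<Rightarrow> complex" where "ind B = (\<lambda>x. if x \<in> B then 1 else 0)" for B
  have finY: "finite Y" using part fin by (rule finite_elements[rotated])
  have sub: "\<And>B. B \<in> Y \<Longrightarrow> B \<subseteq> A" using part by (auto simp: partition_on_def)
  have block: "\<exists>B\<in>Y. x \<in> B" if "x \<in> A" for x using part that by (auto simp: partition_on_def)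
  have uniq: "B = B'" if "B \<in> Y" "B' \<in> Y" "x \<in> B" "x \<in> B'" for B B' x
    using part that by (auto simp: partition_on_def disjoint_def)
  have in_span: "res u \<in> V.span (ind ` Y)"
    if u: "\<And>B x y. B \<in> Y \<Longrightarrow> x \<in> B \<Longrightarrow> y \<in> B \<Longrightarrow> u x = u y" for u
  proof -
    have "res u = (\<Sum>B\<in>Y. (\<lambda>x. u (SOME y. y \<in> B) * ind B x))"
    proof
      fix x
      show "res u x = (\<Sum>B\<in>Y. (\<lambda>x. u (SOME y. y \<in> B) * ind B x)) x"
      proof (cases "x \<in> A")
        case True
        then obtain B where B: "B \<in> Y" "x \<in> B" using block by blast
        have "(\<Sum>C\<in>Y. u (SOME y. y \<in> C) * ind C x) = (\<Sum>C\<in>{B}. u (SOME y. y \<in> C) * ind C x)"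
          using B finY uniq by (intro sum.mono_neutral_right) (auto simp: ind_def)
        also have "\<dots> = u x"
          using B u[OF B(1), of "SOME y. y \<in> B" x] someI[of "\<lambda>y. y \<in> B", OF B(2)] by (simp add: ind_def)
        finally show ?thesis using True by (simp add: res_def sum_fun_apply)
      next
        case False
        then have "u (SOME y. y \<in> B) * ind B x = 0" if "B \<in> Y" for B
          using sub[OF that] by (auto simp: ind_def)
        then show ?thesis using False by (simp add: res_def sum_fun_apply)
      qed
    qed
    also have "\<dots> \<in> V.span (ind ` Y)"
      by (intro V.span_sum V.span_scale V.span_base) auto
    finally show ?thesis .
  qed
  define \<Phi> where "\<Phi> = (\<lambda>i. res (f i)) ` I"
  have pair: "(\<Sum>x\<in>A. res (f i) x * h j x) = (\<Sum>x\<in>A. f i x * h j x)" for i j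
    by (simp add: res_def)
  have inj: "inj_on (\<lambda>i. res (f i)) I"
  proof (rule inj_onI, rule ccontr)
    fix i j assume "i \<in> I" "j \<in> I" "res (f i) = res (f j)" "i \<noteq> j"
    then show False using off[of i j] diag[of j] pair[of i j] pair[of j j] by simp
  qed
  have indep: "V.independent \<Phi>"
    unfolding V.independent_explicit_module
  proof (intro allI impI)
    fix t c v assume t: "finite t" "t \<subseteq> \<Phi>" and z: "(\<Sum>v\<in>t. (\<lambda>x. c v * v x)) = 0" and v: "v \<in> t"
    obtain j where j: "j \<in> I" "v = res (f j)" using t v by (auto simp: \<Phi>_def)
    (* Pairing the relation with the dual function of v isolates the coefficient of v. *)
    have "0 = (\<Sum>x\<in>A. (\<Sum>w\<in>t. (\<lambda>x. c w * w x)) x * h j x)" by (simp add: z)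
    also have "\<dots> = (\<Sum>w\<in>t. c w * (\<Sum>x\<in>A. w x * h j x))"
      by (simp add: sum_fun_apply sum_distrib_left sum_distrib_right mult.assoc) (rule sum.swap)
    also have "\<dots> = (\<Sum>w\<in>{v}. c w * (\<Sum>x\<in>A. w x * h j x))"
    proof (rule sum.mono_neutral_right)
      show "\<forall>w\<in>t - {v}. c w * (\<Sum>x\<in>A. w x * h j x) = 0"
      proof
        fix w assume w: "w \<in> t - {v}"
        then obtain i where i: "i \<in> I" "w = res (f i)" using t by (auto simp: \<Phi>_def)
        then have "i \<noteq> j" using w j by auto
        then show "c w * (\<Sum>x\<in>A. w x * h j x) = 0" using i j pair off by simp
      qed
    qed (use t v in auto)
    finally show "c v = 0" using diag[OF j(1)] pair[of j j] j by simp
  qed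
  have span: "\<Phi> \<subseteq> V.span (ind ` Y)"
    unfolding \<Phi>_def by (rule image_subsetI, rule in_span, rule const)
  have fin\<Phi>: "finite \<Phi>" using V.independent_span_bound[OF _ indep span] finY by simp
  then show finI: "finite I" using inj by (simp add: \<Phi>_def finite_image_iff)
  assume card: "card I = card Y"
    and F: "\<And>B x y. B \<in> Y \<Longrightarrow> x \<in> B \<Longrightarrow> y \<in> B \<Longrightarrow> F x = F y"
  have "res F \<in> V.span \<Phi>"
  proof (rule ccontr)
    assume n: "res F \<notin> V.span \<Phi>"
    then have "V.independent (insert (res F) \<Phi>)" by (rule V.independent_insertI[OF _ indep])
    moreover have "insert (res F) \<Phi> \<subseteq> V.span (ind ` Y)" using span in_span F by blast
    ultimately have "card (insert (res F) \<Phi>) \<le> card (ind ` Y)"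
      using V.independent_span_bound finY by blast
    also have "\<dots> \<le> card I" using finY card by (simp add: card_image_le)
    also have "\<dots> = card \<Phi>" using inj by (simp add: \<Phi>_def card_image)
    finally show False using fin\<Phi> n V.span_base by (auto simp: card_insert_if split: if_splits)
  qed
  then obtain c where c: "res F = (\<Sum>v\<in>\<Phi>. (\<lambda>x. c v * v x))"
    using V.span_finite[OF fin\<Phi>] by auto
  have "F x = (\<Sum>i\<in>I. c (res (f i)) * f i x)" if "x \<in> A" for x
  proof -
    have "F x = (\<Sum>v\<in>\<Phi>. c v * v x)"
      using fun_cong[OF c, of x] that by (simp add: res_def sum_fun_apply)
    also have "\<dots> = (\<Sum>i\<in>I. c (res (f i)) * f i x)"
      unfolding \<Phi>_def using that by (subst sum.reindex[OF inj]) (simp add: res_def)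
    finally show ?thesis .
  qed
  then show "\<exists>c. \<forall>x\<in>A. F x = (\<Sum>i\<in>I. c i * f i x)" by (intro exI[of _ "\<lambda>i. c (res (f i))"]) blast
qed

section \<open>Orthogonality of irreducible characters\<close>

context finite_group
begin

lemma sum_left_translate:
  fixes f :: "'a \<Rightarrow> 'c::comm_monoid_add"
  assumes "h \<in> carrier G"
  shows "(\<Sum>g\<in>carrier G. f (h \<otimes> g)) = (\<Sum>g\<in>carrier G. f g)"
proof (rule sum.reindex_bij_witness[where i = "\<lambda>g. inv h \<otimes> g" and j = "\<lambda>g. h \<otimes> g"])
qed (use assms in \<open>auto simp: m_assoc[symmetric]\<close>)

text \<open>This is \<open>\<Sum>\<^sub>g \<rho>(g) E \<tau>(g\<^sup>-\<^sup>1)\<close> for the matrix unit \<open>E\<close> at position \<open>(j, k)\<close>, written out in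
entries.\<close>

definition avg_mat where
  "avg_mat n m \<rho> \<tau> j k =
     mat n m (\<lambda>(a, b). \<Sum>g\<in>carrier G. \<rho> g $$ (a, j) * (\<tau> (inv g) $$ (k, b) :: complex))"

lemma avg_mat_intertwines:
  assumes irr\<rho>: "irreducible_rep G n \<rho>" and irr\<tau>: "irreducible_rep G m \<tau>"
    and jk: "j < n" "k < m" and h: "h \<in> carrier G"
  shows "\<rho> h * avg_mat n m \<rho> \<tau> j k = avg_mat n m \<rho> \<tau> j k * \<tau> h"
proof (rule eq_matI)
  note [simp] = rep_dim[OF irr\<rho>] rep_dim[OF irr\<tau>]
  fix a b assume "a < dim_row (avg_mat n m \<rho> \<tau> j k * \<tau> h)" "b < dim_col (avg_mat n m \<rho> \<tau> j k * \<tau> h)"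
  then have ab: "a < n" "b < m" using h by (auto simp: avg_mat_def)
  have "(\<rho> h * avg_mat n m \<rho> \<tau> j k) $$ (a, b) =
      (\<Sum>c<n. \<rho> h $$ (a, c) * (\<Sum>g\<in>carrier G. \<rho> g $$ (c, j) * \<tau> (inv g) $$ (k, b)))"
    using h ab by (simp add: avg_mat_def scalar_prod_def atLeast0LessThan)
  also have "\<dots> = (\<Sum>g\<in>carrier G. (\<Sum>c<n. \<rho> h $$ (a, c) * \<rho> g $$ (c, j)) * \<tau> (inv g) $$ (k, b))"
    by (simp add: sum_distrib_left sum_distrib_right mult.assoc) (rule sum.swap)
  also have "\<dots> = (\<Sum>g\<in>carrier G. \<rho> (h \<otimes> g) $$ (a, j) * \<tau> (inv g) $$ (k, b))"
    using h ab jk by (intro sum.cong) (auto simp: rep_mult[OF irr\<rho>] scalar_prod_def atLeast0LessThan)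
  also have "\<dots> = (\<Sum>g\<in>carrier G. \<rho> (h \<otimes> g) $$ (a, j) * \<tau> (inv (h \<otimes> g) \<otimes> h) $$ (k, b))"
    using h by (intro sum.cong) (auto simp: inv_mult_group m_assoc)
  also have "\<dots> = (\<Sum>g\<in>carrier G. \<rho> g $$ (a, j) * \<tau> (inv g \<otimes> h) $$ (k, b))"
    by (rule sum_left_translate[OF h])
  also have "\<dots> = (\<Sum>g\<in>carrier G. \<rho> g $$ (a, j) * (\<Sum>c<m. \<tau> (inv g) $$ (k, c) * \<tau> h $$ (c, b)))"
    using h ab jk by (intro sum.cong) (auto simp: rep_mult[OF irr\<tau>] scalar_prod_def atLeast0LessThan)
  also have "\<dots> = (\<Sum>c<m. (\<Sum>g\<in>carrier G. \<rho> g $$ (a, j) * \<tau> (inv g) $$ (k, c)) * \<tau> h $$ (c, b))"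
    by (simp add: sum_distrib_left sum_distrib_right mult.assoc) (rule sum.swap)
  also have "\<dots> = (avg_mat n m \<rho> \<tau> j k * \<tau> h) $$ (a, b)"
    using h ab by (simp add: avg_mat_def scalar_prod_def atLeast0LessThan)
  finally show "(\<rho> h * avg_mat n m \<rho> \<tau> j k) $$ (a, b) = (avg_mat n m \<rho> \<tau> j k * \<tau> h) $$ (a, b)" .
qed (use h rep_dim[OF irr\<rho>] rep_dim[OF irr\<tau>] in \<open>auto simp: avg_mat_def\<close>)

text \<open>The product of two traces is a double sum over diagonal positions \<open>(a, b)\<close>; summed over the
group, its terms are entries of the averaged intertwiners.\<close>

lemma character_pairing_avg:
  assumes irr\<rho>: "irreducible_rep G n \<rho>" and irr\<tau>: "irreducible_rep G m \<tau>"
  shows "(\<Sum>g\<in>carrier G. character_of G \<rho> g * character_of G \<tau> (inv g)) =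
    (\<Sum>a<n. \<Sum>b<m. avg_mat n m \<rho> \<tau> a b $$ (a, b))"
proof -
  have "(\<Sum>g\<in>carrier G. character_of G \<rho> g * character_of G \<tau> (inv g)) =
      (\<Sum>g\<in>carrier G. \<Sum>a<n. \<Sum>b<m. \<rho> g $$ (a, a) * \<tau> (inv g) $$ (b, b))"
    using rep_dim[OF irr\<rho>] rep_dim[OF irr\<tau>]
    by (intro sum.cong) (auto simp: character_of_def mat_trace_def sum_product)
  also have "\<dots> = (\<Sum>a<n. \<Sum>g\<in>carrier G. \<Sum>b<m. \<rho> g $$ (a, a) * \<tau> (inv g) $$ (b, b))"
    by (rule sum.swap)
  also have "\<dots> = (\<Sum>a<n. \<Sum>b<m. \<Sum>g\<in>carrier G. \<rho> g $$ (a, a) * \<tau> (inv g) $$ (b, b))"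
    by (intro sum.cong refl sum.swap)
  also have "\<dots> = (\<Sum>a<n. \<Sum>b<m. avg_mat n m \<rho> \<tau> a b $$ (a, b))"
    by (simp add: avg_mat_def)
  finally show ?thesis .
qed

text \<open>This pairing equals \<open>card (carrier G)\<close> times the Hermitian inner product when \<open>h\<close> is a character, because then
\<open>h (inv g)\<close> is the complex conjugate of \<open>h g\<close>.  In this form it is bilinear and avoids any
discussion of conjugation and unitarity.\<close>

definition pairing :: "('a \<Rightarrow> complex) \<Rightarrow> ('a \<Rightarrow> complex) \<Rightarrow> complex" where
  "pairing f h = (\<Sum>g\<in>carrier G. f g * h (inv g))"

text \<open>Schur orthogonality.  For \<open>\<chi> \<noteq> \<psi>\<close> the averaged intertwiners are zero, since an invertible one would make the
traces agree.  For \<open>\<chi> = \<psi>\<close> both arguments are realised by the same representation and each averaged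
intertwiner is a scalar matrix, whose scalar is found by taking its trace.\<close>

lemma irreducible_characters_orthogonal:
  assumes "\<chi> \<in> Irr G" "\<psi> \<in> Irr G"
  shows "pairing \<chi> \<psi> = (if \<chi> = \<psi> then of_nat (card (carrier G)) else 0)"
proof (cases "\<chi> = \<psi>")
  case True
  obtain \<rho> n where irr: "irreducible_rep G n \<rho>" and \<chi>: "\<chi> = character_of G \<rho>"
    using assms by (auto simp: Irr_def)
  have A: "avg_mat n n \<rho> \<rho> j k \<in> carrier_mat n n" for j k by (auto simp: avg_mat_def)
  have n0: "n > 0" by (rule rep_dim_pos[OF irr])
  have val: "of_nat n * avg_mat n n \<rho> \<rho> a b $$ (a, b) = (if a = b then of_nat (card (carrier G)) else 0)"
    if ab: "a < n" "b < n" for a b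
  proof -
    obtain c where c: "avg_mat n n \<rho> \<rho> a b = c \<cdot>\<^sub>m 1\<^sub>m n"
      using commuting_matrix_scalar[OF irr A avg_mat_intertwines[OF irr irr ab]] by metis
    have "of_nat n * c = mat_trace (avg_mat n n \<rho> \<rho> a b)"
      by (simp add: c mat_trace_def)
    also have "\<dots> = (\<Sum>i<n. \<Sum>g\<in>carrier G. \<rho> (inv g) $$ (b, i) * \<rho> g $$ (i, a))"
      by (simp add: mat_trace_def avg_mat_def mult.commute)
    also have "\<dots> = (\<Sum>g\<in>carrier G. \<Sum>i<n. \<rho> (inv g) $$ (b, i) * \<rho> g $$ (i, a))"
      by (rule sum.swap)
    also have "\<dots> = (\<Sum>g\<in>carrier G. (\<rho> (inv g) * \<rho> g) $$ (b, a))"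
      using ab rep_dim[OF irr] by (intro sum.cong) (auto simp: scalar_prod_def atLeast0LessThan)
    also have "\<dots> = (\<Sum>g\<in>carrier G. if a = b then 1 else 0)"
      using ab rep_l_inv[OF irr] by (intro sum.cong) auto
    finally show ?thesis using ab by (auto simp: c)
  qed
  have "of_nat n * pairing \<chi> \<psi> = (\<Sum>a<n. \<Sum>b<n. of_nat n * avg_mat n n \<rho> \<rho> a b $$ (a, b))"
    using True character_pairing_avg[OF irr irr] by (simp add: pairing_def \<chi> sum_distrib_left)
  also have "\<dots> = (\<Sum>a<n. \<Sum>b<n. if a = b then of_nat (card (carrier G)) else 0)"
    by (simp add: val)
  also have "\<dots> = of_nat n * of_nat (card (carrier G))"
    by (simp add: sum.delta)
  finally show ?thesis using n0 True by simp
next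
  case False
  obtain \<rho> n where irr\<rho>: "irreducible_rep G n \<rho>" and \<chi>: "\<chi> = character_of G \<rho>"
    using assms by (auto simp: Irr_def)
  obtain \<tau> m where irr\<tau>: "irreducible_rep G m \<tau>" and \<psi>: "\<psi> = character_of G \<tau>"
    using assms by (auto simp: Irr_def)
  have "avg_mat n m \<rho> \<tau> j k = 0\<^sub>m n m" if jk: "j < n" "k < m" for j k
  proof (rule ccontr)
    define T where "T = avg_mat n m \<rho> \<tau> j k"
    assume "avg_mat n m \<rho> \<tau> j k \<noteq> 0\<^sub>m n m"
    moreover have T: "T \<in> carrier_mat n m" by (auto simp: T_def avg_mat_def)
    moreover have inter: "\<And>g. g \<in> carrier G \<Longrightarrow> \<rho> g * T = T * \<tau> g"
      unfolding T_def by (rule avg_mat_intertwines[OF irr\<rho> irr\<tau> jk])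
    ultimately obtain U where U: "U \<in> carrier_mat m n" "T * U = 1\<^sub>m n" "U * T = 1\<^sub>m m"
      using Schur[OF irr\<rho> irr\<tau>] T_def by metis
    have "mat_trace (\<rho> g) = mat_trace (\<tau> g)" if g: "g \<in> carrier G" for g
    proof -
      note c = rep_carrier[OF irr\<rho> g] rep_carrier[OF irr\<tau> g]
      have "\<rho> g = \<rho> g * (T * U)" using U c by simp
      also have "\<dots> = T * \<tau> g * U" using assoc_mult_mat[OF c(1) T U(1)] inter[OF g] by simp
      also have "\<dots> = T * (\<tau> g * U)" using T c(2) U(1) by (rule assoc_mult_mat)
      finally have "mat_trace (\<rho> g) = mat_trace (\<tau> g * U * T)"
        using mat_trace_mult_comm[of T n m "\<tau> g * U"] T c U by simp
      also have "\<tau> g * U * T = \<tau> g" using assoc_mult_mat[OF c(2) U(1) T] U c by simp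
      finally show ?thesis .
    qed
    then have "\<chi> = \<psi>" by (auto simp: \<chi> \<psi> character_of_def intro!: restrict_ext)
    with False show False by simp
  qed
  then show ?thesis using False character_pairing_avg[OF irr\<rho> irr\<tau>] by (simp add: pairing_def \<chi> \<psi>)
qed

lemma finite_Irr: "finite (Irr G)"
proof (rule biorthogonal_span(1))
  show "partition_on (carrier G) ((\<lambda>g. {g}) ` carrier G)"
    by (auto simp: partition_on_def disjoint_def)
  show "(\<Sum>g\<in>carrier G. \<chi> g * \<psi> (inv g)) = 0" if "\<chi> \<in> Irr G" "\<psi> \<in> Irr G" "\<chi> \<noteq> \<psi>" for \<chi> \<psi>
    using irreducible_characters_orthogonal[OF that(1,2)] that(3) by (simp add: pairing_def)
  show "(\<Sum>g\<in>carrier G. \<chi> g * \<chi> (inv g)) \<noteq> 0" if "\<chi> \<in> Irr G" for \<chi>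
    using irreducible_characters_orthogonal[OF that that] carrier_not_empty by (simp add: pairing_def)
qed auto

end


section \<open>Central elements and normal subgroups in irreducible representations\<close>

context finite_group
begin

lemma character_one:
  assumes "irreducible_rep G n \<rho>"
  shows "character_of G \<rho> \<one> = of_nat n"
  using rep_one[OF assms] by (simp add: character_of_def mat_trace_def)

lemma IrrE:
  assumes "\<chi> \<in> Irr G"
  obtains \<rho> n where "irreducible_rep G n \<rho>" "\<chi> = character_of G \<rho>" "\<chi> \<one> = of_nat n" "n > 0"
  using assms character_one rep_dim_pos by (auto simp: Irr_def)

lemma Irr_one_neq_0: "\<chi> \<in> Irr G \<Longrightarrow> \<chi> \<one> \<noteq> 0"
  by (elim IrrE) simp

text \<open>Degrees are positive integers, so their squares cannot cancel; this is \<open>\<sigma>\<^sub>X(1) \<noteq> 0\<close>.\<close>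

lemma sum_degree_squares_neq_0:
  assumes "X \<subseteq> Irr G" "X \<noteq> {}"
  shows "(\<Sum>\<chi>\<in>X. \<chi> \<one> * \<chi> \<one>) \<noteq> 0"
proof -
  have fin: "finite X" using assms finite_Irr finite_subset by blast
  have "\<exists>d::nat. d > 0 \<and> \<chi> \<one> = of_nat d" if "\<chi> \<in> X" for \<chi>
    using that assms IrrE by blast
  then obtain d :: "_ \<Rightarrow> nat" where d: "\<And>\<chi>. \<chi> \<in> X \<Longrightarrow> d \<chi> > 0 \<and> \<chi> \<one> = of_nat (d \<chi>)" by metis
  have "(\<Sum>\<chi>\<in>X. \<chi> \<one> * \<chi> \<one>) = of_nat (\<Sum>\<chi>\<in>X. d \<chi> * d \<chi>)"
    using d by simp
  moreover have "(\<Sum>\<chi>\<in>X. d \<chi> * d \<chi>) \<noteq> 0"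
    using d fin assms(2) by auto
  ultimately show ?thesis by (metis of_nat_eq_0_iff)
qed

lemma Irr_conj:
  assumes "\<chi> \<in> Irr G" "g \<in> carrier G" "x \<in> carrier G"
  shows "\<chi> (x \<otimes> g \<otimes> inv x) = \<chi> g"
  using assms(1)
proof (rule IrrE)
  fix \<rho> n assume irr: "irreducible_rep G n \<rho>" and \<chi>: "\<chi> = character_of G \<rho>"
  note c = rep_carrier[OF irr]
  have "mat_trace (\<rho> (x \<otimes> g \<otimes> inv x)) = mat_trace (\<rho> x * (\<rho> g * \<rho> (inv x)))"
    using assms c by (simp add: rep_mult[OF irr] m_assoc)
  also have "\<dots> = mat_trace (\<rho> g * \<rho> (inv x) * \<rho> x)"
    by (rule mat_trace_mult_comm[OF c mult_carrier_mat[OF c c]]) (use assms in auto)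
  also have "\<rho> g * \<rho> (inv x) * \<rho> x = \<rho> (g \<otimes> inv x \<otimes> x)"
    using assms by (simp add: rep_mult[OF irr])
  also have "g \<otimes> inv x \<otimes> x = g" using assms by (simp add: m_assoc)
  finally show ?thesis using assms by (simp add: \<chi> character_of_def)
qed

text \<open>The hypothesis asks for commutation in the image of \<open>\<rho>\<close> only.  It is applied to central elements of \<open>G\<close>, and
also to arbitrary elements when \<open>\<rho>\<close> identifies all conjugates.\<close>

lemma commuting_element_scalar:
  assumes irr: "irreducible_rep G n \<rho>" and z: "z \<in> carrier G"
    and comm: "\<And>g. g \<in> carrier G \<Longrightarrow> \<rho> (g \<otimes> z) = \<rho> (z \<otimes> g)"
  obtains c where "c \<noteq> 0" "\<And>g. g \<in> carrier G \<Longrightarrow> character_of G \<rho> (z \<otimes> g) = c * character_of G \<rho> g"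
proof -
  obtain c where c: "\<rho> z = c \<cdot>\<^sub>m 1\<^sub>m n"
    using commuting_matrix_scalar[OF irr rep_carrier[OF irr z]] comm z
    by (metis rep_mult[OF irr])
  show ?thesis
  proof
    show "character_of G \<rho> (z \<otimes> g) = c * character_of G \<rho> g" if g: "g \<in> carrier G" for g
    proof -
      have "\<rho> (z \<otimes> g) = c \<cdot>\<^sub>m \<rho> g"
        using z g rep_carrier[OF irr g]
        by (simp add: rep_mult[OF irr] c mult_smult_assoc_mat[of _ n n _ n])
      then show ?thesis using z g rep_dim[OF irr g]
        by (simp add: character_of_def mat_trace_def sum_distrib_left)
    qed
    show "c \<noteq> 0"
    proof
      assume "c = 0"
      then have "\<rho> z * \<rho> (inv z) = 0\<^sub>m n n" using z rep_carrier[OF irr, of "inv z"] c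
        by (simp add: mult_smult_assoc_mat[of _ n n _ n] smult_zero_mat) (auto intro!: eq_matI)
      then have "(1\<^sub>m n :: complex mat) $$ (0, 0) = (0\<^sub>m n n) $$ (0, 0)"
        using rep_r_inv[OF irr z] by simp
      then show False using rep_dim_pos[OF irr] by simp
    qed
  qed
qed

text \<open>The matrix \<open>P = \<Sum>\<^sub>h\<^sub>\<in>\<^sub>N \<rho>(h)\<close> commutes with the representation because \<open>N\<close> is normal, so it is a scalar \<open>c\<close>, and
\<open>c \<noteq> 0\<close> because its trace is the given sum.  Cancelling \<open>P\<close> in \<open>\<rho>(m) P = P\<close> gives the claim.
This dichotomy (the character sums to zero over \<open>N\<close>, or \<open>N\<close> acts trivially) replaces any estimate
of \<open>\<bar>\<chi>(g)\<bar>\<close> by \<open>\<chi>(1)\<close>.\<close>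

lemma normal_sum_rep:
  assumes irr: "irreducible_rep G n \<rho>" and N: "N \<lhd> G"
    and nz: "(\<Sum>h\<in>N. character_of G \<rho> h) \<noteq> 0" and m: "m \<in> N"
  shows "\<rho> m = 1\<^sub>m n"
proof -
  interpret N: normal N G by (rule N)
  have NG: "\<And>h. h \<in> N \<Longrightarrow> h \<in> carrier G" using N.subset by blast
  define P where "P = mat n n (\<lambda>(a, b). \<Sum>h\<in>N. \<rho> h $$ (a, b))"
  have P: "P \<in> carrier_mat n n" by (auto simp: P_def)
  have left: "(\<rho> g * P) $$ (a, b) = (\<Sum>h\<in>N. \<rho> (g \<otimes> h) $$ (a, b))"
    if "g \<in> carrier G" "a < n" "b < n" for g a b
  proof -
    have "(\<rho> g * P) $$ (a, b) = (\<Sum>c<n. \<Sum>h\<in>N. \<rho> g $$ (a, c) * \<rho> h $$ (c, b))"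
      using that rep_dim[OF irr] by (simp add: P_def scalar_prod_def atLeast0LessThan sum_distrib_left)
    also have "\<dots> = (\<Sum>h\<in>N. \<Sum>c<n. \<rho> g $$ (a, c) * \<rho> h $$ (c, b))" by (rule sum.swap)
    also have "\<dots> = (\<Sum>h\<in>N. \<rho> (g \<otimes> h) $$ (a, b))"
      using that rep_dim[OF irr] NG
      by (intro sum.cong) (auto simp: rep_mult[OF irr] scalar_prod_def atLeast0LessThan)
    finally show ?thesis .
  qed
  have right: "(P * \<rho> g) $$ (a, b) = (\<Sum>h\<in>N. \<rho> (h \<otimes> g) $$ (a, b))"
    if "g \<in> carrier G" "a < n" "b < n" for g a b
  proof -
    have "(P * \<rho> g) $$ (a, b) = (\<Sum>c<n. \<Sum>h\<in>N. \<rho> h $$ (a, c) * \<rho> g $$ (c, b))"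
      using that rep_dim[OF irr] by (simp add: P_def scalar_prod_def atLeast0LessThan sum_distrib_right)
    also have "\<dots> = (\<Sum>h\<in>N. \<Sum>c<n. \<rho> h $$ (a, c) * \<rho> g $$ (c, b))" by (rule sum.swap)
    also have "\<dots> = (\<Sum>h\<in>N. \<rho> (h \<otimes> g) $$ (a, b))"
      using that rep_dim[OF irr] NG
      by (intro sum.cong) (auto simp: rep_mult[OF irr] scalar_prod_def atLeast0LessThan)
    finally show ?thesis .
  qed
  have comm: "\<rho> g * P = P * \<rho> g" if g: "g \<in> carrier G" for g
  proof (rule eq_matI)
    fix a b assume "a < dim_row (P * \<rho> g)" "b < dim_col (P * \<rho> g)"
    then have ab: "a < n" "b < n" using P g rep_dim[OF irr] by auto
    have "(\<Sum>h\<in>N. \<rho> (g \<otimes> h) $$ (a, b)) = (\<Sum>h\<in>N. \<rho> (h \<otimes> g) $$ (a, b))"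
    proof (rule sum.reindex_bij_witness[where j = "\<lambda>h. g \<otimes> h \<otimes> inv g" and i = "\<lambda>h. inv g \<otimes> h \<otimes> g"])
      fix h assume h: "h \<in> N"
      show "inv g \<otimes> (g \<otimes> h \<otimes> inv g) \<otimes> g = h"
        using g NG[OF h] by (simp add: m_assoc) (simp add: m_assoc[symmetric])
      show "g \<otimes> (inv g \<otimes> h \<otimes> g) \<otimes> inv g = h"
        using g NG[OF h] by (simp add: m_assoc) (simp add: m_assoc[symmetric])
      show "g \<otimes> h \<otimes> inv g \<in> N" using g h by (rule N.inv_op_closed2)
      show "inv g \<otimes> h \<otimes> g \<in> N" using g h by (rule N.inv_op_closed1)
      show "\<rho> (g \<otimes> h \<otimes> inv g \<otimes> g) $$ (a, b) = \<rho> (g \<otimes> h) $$ (a, b)"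
        using g NG[OF h] by (simp add: m_assoc)
    qed
    then show "(\<rho> g * P) $$ (a, b) = (P * \<rho> g) $$ (a, b)"
      using left right g ab by simp
  qed (use P g rep_dim[OF irr] in auto)
  obtain c where c: "P = c \<cdot>\<^sub>m 1\<^sub>m n"
    using commuting_matrix_scalar[OF irr P comm] by metis
  have "(\<Sum>h\<in>N. character_of G \<rho> h) = (\<Sum>h\<in>N. \<Sum>i<n. \<rho> h $$ (i, i))"
    using NG rep_dim[OF irr] by (simp add: character_of_def mat_trace_def)
  also have "\<dots> = (\<Sum>i<n. P $$ (i, i))" by (subst sum.swap) (simp add: P_def)
  also have "\<dots> = of_nat n * c" by (simp add: c)
  finally have c0: "c \<noteq> 0" using nz by auto
  have mG: "m \<in> carrier G" using m NG by blast
  have "\<rho> m * P = P"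
  proof (rule eq_matI)
    fix a b assume "a < dim_row P" "b < dim_col P"
    then have ab: "a < n" "b < n" using P by auto
    have "(\<Sum>h\<in>N. \<rho> (m \<otimes> h) $$ (a, b)) = (\<Sum>h\<in>N. \<rho> h $$ (a, b))"
      by (rule sum.reindex_bij_witness[where j = "\<lambda>h. m \<otimes> h" and i = "\<lambda>h. inv m \<otimes> h"])
        (use m mG NG in \<open>auto simp: m_assoc[symmetric]\<close>)
    then show "(\<rho> m * P) $$ (a, b) = P $$ (a, b)"
      using left[OF mG ab] ab by (simp add: P_def)
  qed (use P mG rep_dim[OF irr] in auto)
  moreover have "\<rho> m * P = c \<cdot>\<^sub>m \<rho> m"
    using rep_carrier[OF irr mG] by (simp add: c mult_smult_distrib[of _ n n _ n])
  ultimately have "c \<cdot>\<^sub>m \<rho> m = c \<cdot>\<^sub>m 1\<^sub>m n" using c by simp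
  then show ?thesis using c0 rep_dim[OF irr mG] by (auto simp: mat_eq_iff)
qed

text \<open>For a normal subgroup inside the kernel of the character, the sum of the character over it is
non-zero, so the previous lemma applies.\<close>

lemma normal_in_char_ker_rep:
  assumes irr: "irreducible_rep G n \<rho>" and N: "N \<lhd> G"
    and ker: "N \<subseteq> char_ker G (character_of G \<rho>)" and m: "m \<in> N"
  shows "\<rho> m = 1\<^sub>m n"
proof (rule normal_sum_rep[OF irr N _ m])
  have fin: "finite N" using ker finite_subset by (fastforce simp: char_ker_def)
  have "(\<Sum>h\<in>N. character_of G \<rho> h) = of_nat (card N) * of_nat n"
    using ker by (simp add: char_ker_def subset_iff character_one[OF irr])
  then show "(\<Sum>h\<in>N. character_of G \<rho> h) \<noteq> 0"
    using fin m rep_dim_pos[OF irr] by auto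
qed

lemma Irr_normal_sum:
  assumes "\<chi> \<in> Irr G" and N: "N \<lhd> G" and nz: "(\<Sum>h\<in>N. \<chi> h) \<noteq> 0"
  shows "N \<subseteq> char_ker G \<chi>"
  using assms(1)
proof (rule IrrE)
  fix \<rho> n assume irr: "irreducible_rep G n \<rho>" and \<chi>: "\<chi> = character_of G \<rho>"
  interpret N: normal N G by (rule N)
  show ?thesis
  proof
    fix m assume m: "m \<in> N"
    have "\<rho> m = \<rho> \<one>" using normal_sum_rep[OF irr N _ m] nz rep_one[OF irr] by (simp add: \<chi>)
    then show "m \<in> char_ker G \<chi>"
      using m N.subset by (simp add: char_ker_def \<chi> character_of_def subsetD)
  qed
qed

end

section \<open>Expansion in supercharacters\<close>

locale supercharacters = finite_group +
  fixes S :: "'a sct"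
  assumes sct: "supercharacter_theory G S"
begin

abbreviation "\<sigma> \<equiv> sigma_char G"

lemma part_subset_Irr: "X \<in> fst S \<Longrightarrow> X \<subseteq> Irr G"
  using sct by (auto simp: supercharacter_theory_def partition_on_def)

lemma part_nonempty: "X \<in> fst S \<Longrightarrow> X \<noteq> {}"
  using sct by (auto simp: supercharacter_theory_def partition_on_def)

lemma part_unique: "X \<in> fst S \<Longrightarrow> X' \<in> fst S \<Longrightarrow> \<chi> \<in> X \<Longrightarrow> \<chi> \<in> X' \<Longrightarrow> X = X'"
  using sct by (auto simp: supercharacter_theory_def partition_on_def disjoint_def)

lemma part_finite: "X \<in> fst S \<Longrightarrow> finite X"
  using part_subset_Irr finite_Irr finite_subset by blast

lemma classes_partition: "partition_on (carrier G) (snd S)"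
  using sct by (simp add: supercharacter_theory_def)

lemma S_class_eq:
  assumes "Y \<in> snd S" "g \<in> Y"
  shows "S_class S g = Y"
  unfolding S_class_def
proof (rule the_equality)
  fix Y' assume "Y' \<in> snd S \<and> g \<in> Y'"
  then show "Y' = Y"
    using partition_onD2[OF classes_partition] assms by (auto dest: disjointD)
qed (use assms in blast)

lemma S_class:
  assumes "g \<in> carrier G"
  shows "S_class S g \<in> snd S" "g \<in> S_class S g"
proof -
  obtain Y where "Y \<in> snd S" "g \<in> Y"
    using assms partition_onD1[OF classes_partition] by blast
  then show "S_class S g \<in> snd S" "g \<in> S_class S g" using S_class_eq by auto
qed

lemma S_class_subset: "g \<in> carrier G \<Longrightarrow> S_class S g \<subseteq> carrier G"
  using S_class(1)[of g] sct by (auto simp: supercharacter_theory_def partition_on_def)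

lemma S_class_one: "S_class S \<one> = {\<one>}"
  using sct by (intro S_class_eq) (auto simp: supercharacter_theory_def)

definition superclass_fun :: "('a \<Rightarrow> complex) \<Rightarrow> bool" where
  "superclass_fun F \<longleftrightarrow> (\<forall>g\<in>carrier G. \<forall>k\<in>S_class S g. F k = F g)"

lemma superclass_funI:
  "(\<And>g k. g \<in> carrier G \<Longrightarrow> k \<in> S_class S g \<Longrightarrow> F k = F g) \<Longrightarrow> superclass_fun F"
  by (simp add: superclass_fun_def)

lemma superclass_funD:
  "superclass_fun F \<Longrightarrow> g \<in> carrier G \<Longrightarrow> k \<in> S_class S g \<Longrightarrow> F k = F g"
  by (simp add: superclass_fun_def)

lemma superclass_fun_cong:
  "(\<And>g. g \<in> carrier G \<Longrightarrow> F g = F' g) \<Longrightarrow> superclass_fun F \<longleftrightarrow> superclass_fun F'"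
  using S_class_subset unfolding superclass_fun_def by (metis subsetD)

lemma superclass_fun_sigma: "X \<in> fst S \<Longrightarrow> superclass_fun (\<sigma> X)"
  using sct S_class unfolding supercharacter_theory_def by (intro superclass_funI) blast

lemma sigma_apply: "g \<in> carrier G \<Longrightarrow> \<sigma> X g = (\<Sum>\<chi>\<in>X. \<chi> \<one> * \<chi> g)"
  by (simp add: sigma_char_def)

lemma sigma_one_neq_0: "X \<in> fst S \<Longrightarrow> \<sigma> X \<one> \<noteq> 0"
  using sum_degree_squares_neq_0 part_subset_Irr part_nonempty by (simp add: sigma_apply)

lemma pairing_sigma:
  assumes X: "X \<in> fst S" and \<psi>: "\<psi> \<in> Irr G"
  shows "pairing (\<sigma> X) \<psi> = (if \<psi> \<in> X then \<psi> \<one> * of_nat (card (carrier G)) else 0)"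
proof -
  have "pairing (\<sigma> X) \<psi> = (\<Sum>\<chi>\<in>X. \<chi> \<one> * pairing \<chi> \<psi>)"
    by (simp add: pairing_def sigma_apply sum_distrib_left sum_distrib_right mult.assoc) (rule sum.swap)
  also have "\<dots> = (\<Sum>\<chi>\<in>X. if \<chi> = \<psi> then \<psi> \<one> * of_nat (card (carrier G)) else 0)"
    using part_subset_Irr[OF X] \<psi> irreducible_characters_orthogonal
    by (intro sum.cong) auto
  finally show ?thesis using part_finite[OF X] by (simp add: sum.delta)
qed

lemma pairing_sigma_sigma:
  assumes X: "X \<in> fst S" and X': "X' \<in> fst S"
  shows "pairing (\<sigma> X) (\<sigma> X') = (if X = X' then of_nat (card (carrier G)) * \<sigma> X \<one> else 0)"
proof -
  have "pairing (\<sigma> X) (\<sigma> X') = (\<Sum>\<psi>\<in>X'. \<psi> \<one> * pairing (\<sigma> X) \<psi>)"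
    by (simp add: pairing_def sigma_apply[of "inv _"] sum_distrib_left mult.left_commute) (rule sum.swap)
  also have "\<dots> = (\<Sum>\<psi>\<in>X'. \<psi> \<one> * (if \<psi> \<in> X then \<psi> \<one> * of_nat (card (carrier G)) else 0))"
    using part_subset_Irr[OF X'] pairing_sigma[OF X] by (intro sum.cong) auto
  also have "\<dots> = (if X = X' then of_nat (card (carrier G)) * \<sigma> X \<one> else 0)"
  proof (cases "X = X'")
    case True
    then show ?thesis by (simp add: sigma_apply sum_distrib_left mult_ac)
  next
    case False
    then have "\<psi> \<notin> X" if "\<psi> \<in> X'" for \<psi> using part_unique[OF X X' _ that] by blast
    then show ?thesis using False by (simp cong: sum.cong)
  qed
  finally show ?thesis .
qed

text \<open>The \<open>S\<close>-characters form a basis of the functions that are constant on \<open>S\<close>-classes.  The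
second conclusion is the coefficient formula; the coefficient of \<open>\<sigma>\<^sub>X\<close> can be computed with whichever
\<open>\<chi> \<in> X\<close> is convenient, which links the members of one part \<open>X\<close> to each other.\<close>

lemma superclass_expansion:
  assumes F: "superclass_fun F"
  obtains c where "\<And>g. g \<in> carrier G \<Longrightarrow> F g = (\<Sum>X\<in>fst S. c X * \<sigma> X g)"
    and "\<And>X \<chi>. X \<in> fst S \<Longrightarrow> \<chi> \<in> X \<Longrightarrow> pairing F \<chi> = c X * \<chi> \<one> * of_nat (card (carrier G))"
proof -
  have card0: "of_nat (card (carrier G)) \<noteq> (0::complex)" using carrier_not_empty by simp
  note part = classes_partition
  have card: "card (fst S) = card (snd S)"
    using sct by (simp add: supercharacter_theory_def)
  have off: "(\<Sum>g\<in>carrier G. \<sigma> X g * \<sigma> X' (inv g)) = 0" if "X \<in> fst S" "X' \<in> fst S" "X \<noteq> X'" for X X'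
    using pairing_sigma_sigma[OF that(1,2)] that(3) by (simp add: pairing_def)
  have diag: "(\<Sum>g\<in>carrier G. \<sigma> X g * \<sigma> X (inv g)) \<noteq> 0" if "X \<in> fst S" for X
    using pairing_sigma_sigma[OF that that] sigma_one_neq_0[OF that] card0 by (simp add: pairing_def)
  have const: "u x = u y" if "superclass_fun u" "B \<in> snd S" "x \<in> B" "y \<in> B" for u B x y
  proof -
    have "x \<in> carrier G" using part that by (auto simp: partition_on_def)
    then show ?thesis using superclass_funD[OF that(1), of x y] S_class_eq that by simp
  qed
  note const_sigma = const[OF superclass_fun_sigma]
  have fin: "finite (fst S)"
    by (rule biorthogonal_span(1)[of "carrier G" "snd S" "fst S" \<sigma> "\<lambda>X g. \<sigma> X (inv g)"])
      (use finite_carrier part const_sigma off diag in blast)+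
  have "\<exists>c. \<forall>g\<in>carrier G. F g = (\<Sum>X\<in>fst S. c X * \<sigma> X g)"
    by (rule biorthogonal_span(2)[of "carrier G" "snd S" "fst S" \<sigma> "\<lambda>X g. \<sigma> X (inv g)"])
      (use finite_carrier part const_sigma off diag card const[OF F] in blast)+
  then obtain c where c: "\<And>g. g \<in> carrier G \<Longrightarrow> F g = (\<Sum>X\<in>fst S. c X * \<sigma> X g)"
    by blast
  show ?thesis
  proof (rule that[OF c])
    fix X \<chi> assume X: "X \<in> fst S" and \<chi>: "\<chi> \<in> X"
    have \<chi>I: "\<chi> \<in> Irr G" using part_subset_Irr X \<chi> by blast
    have "pairing F \<chi> = (\<Sum>X'\<in>fst S. c X' * pairing (\<sigma> X') \<chi>)"
      by (simp add: pairing_def c sum_distrib_left sum_distrib_right mult.assoc) (rule sum.swap)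
    also have "\<dots> = (\<Sum>X'\<in>fst S. if X' = X then c X * \<chi> \<one> * of_nat (card (carrier G)) else 0)"
    proof (rule sum.cong[OF refl])
      fix X' assume X': "X' \<in> fst S"
      have "\<chi> \<in> X' \<longleftrightarrow> X' = X" using part_unique[OF X' X _ \<chi>] \<chi> by blast
      then show "c X' * pairing (\<sigma> X') \<chi> = (if X' = X then c X * \<chi> \<one> * of_nat (card (carrier G)) else 0)"
        by (simp add: pairing_sigma[OF X' \<chi>I])
    qed
    finally show "pairing F \<chi> = c X * \<chi> \<one> * of_nat (card (carrier G))"
      using fin X by (simp add: sum.delta)
  qed
qed

text \<open>The indicator of an \<open>S\<close>-class is a combination of characters, hence invariant under conjugation.\<close>

lemma conj_in_S_class:
  assumes g: "g \<in> carrier G" and x: "x \<in> carrier G"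
  shows "x \<otimes> g \<otimes> inv x \<in> S_class S g"
proof -
  define F :: "'a \<Rightarrow> complex" where "F k = (if k \<in> S_class S g then 1 else 0)" for k
  have "superclass_fun F"
  proof (rule superclass_funI)
    fix a k assume a: "a \<in> carrier G" and k: "k \<in> S_class S a"
    have "S_class S k = S_class S a" using S_class(1)[OF a] k by (rule S_class_eq)
    moreover have "k \<in> carrier G" using S_class_subset[OF a] k by blast
    ultimately have "k \<in> S_class S g \<longleftrightarrow> a \<in> S_class S g"
      using S_class(2) S_class_eq[OF S_class(1)[OF g]] a by metis
    then show "F k = F a" by (simp add: F_def)
  qed
  then obtain c where c: "\<And>k. k \<in> carrier G \<Longrightarrow> F k = (\<Sum>X\<in>fst S. c X * \<sigma> X k)"
    using superclass_expansion by metis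
  have "\<sigma> X (x \<otimes> g \<otimes> inv x) = \<sigma> X g" if "X \<in> fst S" for X
    using part_subset_Irr[OF that] g x Irr_conj by (auto simp: sigma_apply intro!: sum.cong)
  then have "F (x \<otimes> g \<otimes> inv x) = F g" using g x by (simp add: c)
  then show ?thesis using S_class(2)[OF g] by (simp add: F_def split: if_splits)
qed

section \<open>The center of a supercharacter theory\<close>

lemma S_center_iff: "z \<in> S_center G S \<longleftrightarrow> z \<in> carrier G \<and> S_class S z = {z}"
  using S_class(2)[of z] by (auto simp: S_center_def card_1_singleton_iff)

lemma S_center_central:
  assumes z: "z \<in> S_center G S" and g: "g \<in> carrier G"
  shows "g \<otimes> z = z \<otimes> g"
proof -
  have zG: "z \<in> carrier G" using z by (simp add: S_center_iff)
  have "g \<otimes> z \<otimes> inv g = z" using conj_in_S_class[OF zG g] z by (simp add: S_center_iff)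
  then have "g \<otimes> z \<otimes> inv g \<otimes> g = z \<otimes> g" by simp
  then show ?thesis using zG g by (simp add: m_assoc)
qed

abbreviation delta :: "'a \<Rightarrow> 'a \<Rightarrow> complex" where
  "delta x \<equiv> (\<lambda>g. if g = x then 1 else 0)"

text \<open>Membership in \<open>Z(S)\<close> becomes a property of a function, to which \<open>superclass_expansion\<close> applies.\<close>

lemma superclass_fun_delta_iff:
  assumes x: "x \<in> carrier G"
  shows "superclass_fun (delta x) \<longleftrightarrow> x \<in> S_center G S"
proof
  assume F: "superclass_fun (delta x)"
  have "k = x" if "k \<in> S_class S x" for k
    using superclass_funD[OF F x that] by (simp split: if_splits)
  then show "x \<in> S_center G S" using x S_class(2)[OF x] by (auto simp: S_center_iff)
next
  assume "x \<in> S_center G S"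
  then have x1: "S_class S x = {x}" by (simp add: S_center_iff)
  show "superclass_fun (delta x)"
  proof (rule superclass_funI)
    fix g k assume g: "g \<in> carrier G" and k: "k \<in> S_class S g"
    have "S_class S k = S_class S g" using S_class(1)[OF g] k by (rule S_class_eq)
    then have "k = x \<longleftrightarrow> g = x" using x1 k S_class(2)[OF g] by auto
    then show "delta x k = delta x g" by simp
  qed
qed

text \<open>For \<open>\<chi> \<in> X\<close> the central element \<open>z\<^sup>-\<^sup>1\<close> acts by a scalar \<open>l\<close>, and the pairing of \<open>\<chi>\<close> with the point
mass at \<open>z\<close> is \<open>\<chi>(z\<^sup>-\<^sup>1) = l \<chi>(1)\<close>.  Comparison with the coefficient formula shows that \<open>l\<close> depends on \<open>X\<close> only.\<close>

lemma sigma_translate_center: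
  assumes z: "z \<in> S_center G S" and X: "X \<in> fst S"
  obtains c where "c \<noteq> 0"
    "\<And>g. g \<in> carrier G \<Longrightarrow> \<sigma> X (inv z \<otimes> g) = c * \<sigma> X g"
    "\<And>g. g \<in> carrier G \<Longrightarrow> \<sigma> X (z \<otimes> g) = inverse c * \<sigma> X g"
proof -
  have zG [simp]: "z \<in> carrier G" using z by (simp add: S_center_iff)
  obtain b where b: "\<And>X \<chi>. X \<in> fst S \<Longrightarrow> \<chi> \<in> X \<Longrightarrow>
      pairing (delta z) \<chi> = b X * \<chi> \<one> * of_nat (card (carrier G))"
    using superclass_expansion z superclass_fun_delta_iff[OF zG] by metis
  define c where "c = b X * of_nat (card (carrier G))"
  have scal: "c \<noteq> 0 \<and> (\<forall>g\<in>carrier G. \<chi> (inv z \<otimes> g) = c * \<chi> g)" if \<chi>X: "\<chi> \<in> X" for \<chi>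
  proof -
    have \<chi>I: "\<chi> \<in> Irr G" using part_subset_Irr X \<chi>X by blast
    then obtain \<rho> n where irr: "irreducible_rep G n \<rho>" and \<chi>: "\<chi> = character_of G \<rho>" by (rule IrrE)
    have "\<rho> (g \<otimes> inv z) = \<rho> (inv z \<otimes> g)" if g: "g \<in> carrier G" for g
      using S_center_central[OF z, of "inv g"] g zG by (metis inv_closed inv_inv inv_mult_group)
    then obtain l where l: "l \<noteq> 0" "\<And>g. g \<in> carrier G \<Longrightarrow> \<chi> (inv z \<otimes> g) = l * \<chi> g"
      using commuting_element_scalar[OF irr, of "inv z"] by (metis \<chi> inv_closed zG)
    have "l * \<chi> \<one> = \<chi> (inv z)" using l(2)[of \<one>] by simp
    also have "\<dots> = pairing (delta z) \<chi>"
      by (simp add: pairing_def if_distrib[of "\<lambda>x. x * _"] sum.delta cong: if_cong)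
    also have "\<dots> = c * \<chi> \<one>" using b[OF X \<chi>X] by (simp add: c_def)
    finally have "l = c" using Irr_one_neq_0[OF \<chi>I] by simp
    then show ?thesis using l by blast
  qed
  have c0: "c \<noteq> 0" using scal part_nonempty[OF X] by blast
  have 1: "\<sigma> X (inv z \<otimes> g) = c * \<sigma> X g" if g: "g \<in> carrier G" for g
  proof -
    have "\<chi> \<one> * \<chi> (inv z \<otimes> g) = c * (\<chi> \<one> * \<chi> g)" if "\<chi> \<in> X" for \<chi>
      using scal[OF that] g by simp
    then have "(\<Sum>\<chi>\<in>X. \<chi> \<one> * \<chi> (inv z \<otimes> g)) = (\<Sum>\<chi>\<in>X. c * (\<chi> \<one> * \<chi> g))"
      by (rule sum.cong[OF refl])
    then show ?thesis using g by (simp add: sigma_apply sum_distrib_left)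
  qed
  have 2: "\<sigma> X (z \<otimes> g) = inverse c * \<sigma> X g" if g: "g \<in> carrier G" for g
  proof -
    have "inv z \<otimes> (z \<otimes> g) = g" using g by (simp add: m_assoc[symmetric])
    then have "\<sigma> X g = c * \<sigma> X (z \<otimes> g)" using 1[of "z \<otimes> g"] g by simp
    then show ?thesis using c0 by simp
  qed
  show ?thesis using that c0 1 2 by blast
qed

lemma superclass_fun_translate:
  assumes F: "superclass_fun F" and z: "z \<in> S_center G S"
  shows "superclass_fun (\<lambda>g. F (inv z \<otimes> g))" "superclass_fun (\<lambda>g. F (z \<otimes> g))"
proof -
  have zG [simp]: "z \<in> carrier G" using z by (simp add: S_center_iff)
  obtain b where b: "\<And>g. g \<in> carrier G \<Longrightarrow> F g = (\<Sum>X\<in>fst S. b X * \<sigma> X g)"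
    using superclass_expansion[OF F] by metis
  have *: "\<sigma> X (inv z \<otimes> k) = \<sigma> X (inv z \<otimes> g) \<and> \<sigma> X (z \<otimes> k) = \<sigma> X (z \<otimes> g)"
    if "X \<in> fst S" "g \<in> carrier G" "k \<in> S_class S g" for X g k
  proof -
    have "k \<in> carrier G" using S_class_subset[OF that(2)] that(3) by blast
    then show ?thesis
      using sigma_translate_center[OF z that(1)] that(2)
        superclass_funD[OF superclass_fun_sigma[OF that(1)] that(2,3)]
      by metis
  qed
  show "superclass_fun (\<lambda>g. F (inv z \<otimes> g))" "superclass_fun (\<lambda>g. F (z \<otimes> g))"
    using * S_class_subset by (auto intro!: superclass_funI sum.cong simp: b subset_iff)
qed

text \<open>Translating the point masses at \<open>1\<close> and \<open>w\<close> by \<open>z\<close> gives those at \<open>z\<^sup>-\<^sup>1\<close> and \<open>z w\<close>, and translation by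
\<open>z\<close> preserves functions that are constant on \<open>S\<close>-classes.\<close>

lemma subgroup_S_center: "subgroup (S_center G S) G"
proof (rule subgroupI)
  show "S_center G S \<subseteq> carrier G" by (auto simp: S_center_def)
  have one: "\<one> \<in> S_center G S" by (simp add: S_center_iff S_class_one)
  then show "S_center G S \<noteq> {}" by blast
  fix z assume z: "z \<in> S_center G S"
  then have zG [simp]: "z \<in> carrier G" by (simp add: S_center_iff)
  have eq1: "z \<otimes> g = \<one> \<longleftrightarrow> g = inv z" if "g \<in> carrier G" for g
    using that by (metis inv_equality inv_inv r_inv zG inv_closed)
  have "superclass_fun (\<lambda>g. delta \<one> (z \<otimes> g))"
    using one by (intro superclass_fun_translate(2)[OF _ z, of "delta \<one>"]) (simp add: superclass_fun_delta_iff)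
  then have "superclass_fun (delta (inv z))"
    using eq1 by (subst (asm) superclass_fun_cong[of _ "delta (inv z)"]) simp_all
  then show "inv z \<in> S_center G S" by (simp add: superclass_fun_delta_iff)
  fix w assume w: "w \<in> S_center G S"
  then have wG [simp]: "w \<in> carrier G" by (simp add: S_center_iff)
  have eq2: "inv z \<otimes> g = w \<longleftrightarrow> g = z \<otimes> w" if "g \<in> carrier G" for g
    using that by (metis inv_solve_left zG wG)
  have "superclass_fun (\<lambda>g. delta w (inv z \<otimes> g))"
    using w by (intro superclass_fun_translate(1)[OF _ z, of "delta w"]) (simp add: superclass_fun_delta_iff)
  then have "superclass_fun (delta (z \<otimes> w))"
    using eq2 by (subst (asm) superclass_fun_cong[of _ "delta (z \<otimes> w)"]) simp_all
  then show "z \<otimes> w \<in> S_center G S" by (simp add: superclass_fun_delta_iff)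
qed

section \<open>Normal subgroups of a supercharacter theory and kernels\<close>

lemma S_normalD:
  assumes N: "S_normal G S N" and g: "g \<in> N" and k: "k \<in> S_class S g"
  shows "k \<in> N"
proof -
  obtain C where C: "C \<subseteq> snd S" "N = \<Union>C" using N by (auto simp: S_normal_def)
  then obtain Y where "Y \<in> C" "g \<in> Y" using g by blast
  then show ?thesis using C k S_class_eq by blast
qed

lemma S_normalI:
  assumes N: "subgroup N G" and cl: "\<And>g k. g \<in> N \<Longrightarrow> k \<in> S_class S g \<Longrightarrow> k \<in> N"
  shows "S_normal G S N"
proof -
  have "N = \<Union>(S_class S ` N)"
    using cl S_class(2) subgroup.subset[OF N] by blast
  moreover have "S_class S ` N \<subseteq> snd S"
    using S_class(1) subgroup.subset[OF N] by blast
  ultimately show ?thesis using N by (auto simp: S_normal_def)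
qed

lemma S_normal_imp_normal:
  assumes N: "S_normal G S N"
  shows "N \<lhd> G"
proof -
  have "subgroup N G" using N by (simp add: S_normal_def)
  then show ?thesis
    using S_normalD[OF N] conj_in_S_class subgroup.mem_carrier by (fastforce simp: normal_inv_iff)
qed

lemma S_commutator_mem:
  assumes "g \<in> carrier G" "k \<in> S_class S g"
  shows "inv g \<otimes> k \<in> S_commutator G S"
  using assms unfolding S_commutator_def by (intro generate.incl) blast

text \<open>If \<open>k\<close> lies in the \<open>S\<close>-class of \<open>g \<in> [G,S]\<close>, then \<open>k = g (g\<^sup>-\<^sup>1 k)\<close> is a product of two elements of \<open>[G,S]\<close>.\<close>

lemma S_commutator_S_normal: "S_normal G S (S_commutator G S)"
proof (rule S_normalI)
  show sub: "subgroup (S_commutator G S) G"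
    unfolding S_commutator_def
  proof (rule generate_is_subgroup)
    show "{inv g \<otimes> k |g k. g \<in> carrier G \<and> k \<in> S_class S g} \<subseteq> carrier G"
    proof clarify
      fix g k assume g: "g \<in> carrier G" and k: "k \<in> S_class S g"
      have "k \<in> carrier G" using S_class_subset[OF g] k by blast
      then show "inv g \<otimes> k \<in> carrier G" using g by simp
    qed
  qed
  fix g k assume g: "g \<in> S_commutator G S" and k: "k \<in> S_class S g"
  have gG: "g \<in> carrier G" using sub g by (rule subgroup.mem_carrier)
  have kG: "k \<in> carrier G" using k S_class_subset[OF gG] by blast
  have "g \<otimes> (inv g \<otimes> k) \<in> S_commutator G S"
    using sub g S_commutator_mem[OF gG k] by (rule subgroup.m_closed)
  then show "k \<in> S_commutator G S" using gG kG by (simp add: m_assoc[symmetric])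
qed

lemma sigma_char_kerI:
  assumes "X \<in> fst S" and "\<And>\<chi>. \<chi> \<in> X \<Longrightarrow> N \<subseteq> char_ker G \<chi>"
  shows "N \<subseteq> char_ker G (\<sigma> X)"
proof
  fix g assume g: "g \<in> N"
  obtain \<psi> where "\<psi> \<in> X" using part_nonempty[OF assms(1)] by blast
  then have "g \<in> carrier G" using g assms(2) by (auto simp: char_ker_def)
  moreover have "\<chi> g = \<chi> \<one>" if "\<chi> \<in> X" for \<chi>
    using g assms(2)[OF that] by (auto simp: char_ker_def)
  ultimately show "g \<in> char_ker G (\<sigma> X)"
    by (auto simp: char_ker_def sigma_apply intro!: sum.cong)
qed

text \<open>Sum \<open>\<sigma>\<^sub>X\<close> over \<open>N\<close>.  Each \<open>\<chi> \<in> X\<close> contributes its full share \<open>\<bar>N\<bar> \<chi>(1)\<^sup>2\<close> or nothing at all, according to whether \<open>N\<close>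
lies in its kernel.  The total is \<open>\<bar>N\<bar> \<sigma>\<^sub>X(1)\<close>, so the members of \<open>X\<close> that contribute nothing have degrees
whose squares add up to zero; there are none.\<close>

lemma normal_in_sigma_char_ker:
  assumes X: "X \<in> fst S" and N: "N \<lhd> G" and ker: "N \<subseteq> char_ker G (\<sigma> X)" and \<chi>X: "\<chi> \<in> X"
  shows "N \<subseteq> char_ker G \<chi>"
proof -
  interpret N: normal N G by (rule N)
  have NG: "\<And>h. h \<in> N \<Longrightarrow> h \<in> carrier G" using N.subset by blast
  have card0: "of_nat (card N) \<noteq> (0::complex)"
  proof -
    have "N \<noteq> {}" using N.one_closed by blast
    then show ?thesis using finite_subset[OF N.subset finite_carrier] by (simp add: card_eq_0_iff)
  qed
  (* The members of X that contribute nothing. *)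
  define B where "B = {\<chi> \<in> X. \<not> N \<subseteq> char_ker G \<chi>}"
  have sumB: "(\<Sum>h\<in>N. \<chi> h) = 0" if "\<chi> \<in> B" for \<chi>
  proof -
    have "\<chi> \<in> Irr G" "\<not> N \<subseteq> char_ker G \<chi>" using that part_subset_Irr[OF X] by (auto simp: B_def)
    then show ?thesis using Irr_normal_sum[OF _ N] by blast
  qed
  have sumnB: "(\<Sum>h\<in>N. \<chi> h) = of_nat (card N) * \<chi> \<one>" if "\<chi> \<in> X - B" for \<chi>
  proof -
    have "(\<Sum>h\<in>N. \<chi> h) = (\<Sum>h\<in>N. \<chi> \<one>)"
      using that by (intro sum.cong) (auto simp: B_def char_ker_def)
    then show ?thesis by simp
  qed
  have "(\<Sum>h\<in>N. \<sigma> X h) = (\<Sum>h\<in>N. \<sigma> X \<one>)"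
    using ker by (intro sum.cong) (auto simp: char_ker_def)
  then have "of_nat (card N) * \<sigma> X \<one> = (\<Sum>h\<in>N. \<sigma> X h)" by simp
  also have "\<dots> = (\<Sum>\<chi>\<in>X. \<chi> \<one> * (\<Sum>h\<in>N. \<chi> h))"
    using NG by (simp add: sigma_apply sum_distrib_left) (rule sum.swap)
  also have "\<dots> = (\<Sum>\<chi>\<in>X - B. \<chi> \<one> * (\<Sum>h\<in>N. \<chi> h))"
    using part_finite[OF X] sumB by (intro sum.mono_neutral_right) auto
  also have "\<dots> = of_nat (card N) * (\<Sum>\<chi>\<in>X - B. \<chi> \<one> * \<chi> \<one>)"
    using sumnB by (simp add: sum_distrib_left mult.left_commute)
  finally have "(\<Sum>\<chi>\<in>X. \<chi> \<one> * \<chi> \<one>) = (\<Sum>\<chi>\<in>X - B. \<chi> \<one> * \<chi> \<one>)"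
    using card0 by (simp add: sigma_apply)
  moreover have "(\<Sum>\<chi>\<in>X. \<chi> \<one> * \<chi> \<one>) = (\<Sum>\<chi>\<in>X - B. \<chi> \<one> * \<chi> \<one>) + (\<Sum>\<chi>\<in>B. \<chi> \<one> * \<chi> \<one>)"
    using part_finite[OF X] by (intro sum.subset_diff) (auto simp: B_def)
  ultimately have "(\<Sum>\<chi>\<in>B. \<chi> \<one> * \<chi> \<one>) = 0" by simp
  then have "B = {}" using sum_degree_squares_neq_0[of B] part_subset_Irr[OF X] by (auto simp: B_def)
  then show ?thesis using \<chi>X by (auto simp: B_def)
qed

text \<open>Expand the indicator of \<open>N\<close>.  If the coefficient of \<open>\<sigma>\<^sub>X\<close> is non-zero, then each \<open>\<chi> \<in> X\<close> has a non-zero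
sum over \<open>N\<close>, so \<open>N\<close> lies in the kernel of \<open>\<sigma>\<^sub>X\<close>.  Were \<open>h\<close> in all kernels containing \<open>N\<close>, the
expansion would take the same value at \<open>h\<close> as at \<open>1\<close>, placing \<open>h\<close> in \<open>N\<close>.\<close>

lemma S_normal_separation:
  assumes N: "S_normal G S N" and h: "h \<in> carrier G" "h \<notin> N"
  obtains X where "X \<in> fst S" "N \<subseteq> char_ker G (\<sigma> X)" "h \<notin> char_ker G (\<sigma> X)"
proof (rule ccontr)
  note separated = that
  assume neg: "\<not> thesis"
  have no: "h \<in> char_ker G (\<sigma> X)" if X: "X \<in> fst S" "N \<subseteq> char_ker G (\<sigma> X)" for X
    using neg separated[OF X] by blast
  have sub: "subgroup N G" using N by (simp add: S_normal_def)
  have NG: "N \<subseteq> carrier G" using sub by (rule subgroup.subset)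
  define F :: "'a \<Rightarrow> complex" where "F k = (if k \<in> N then 1 else 0)" for k
  have F: "superclass_fun F"
  proof (rule superclass_funI)
    fix g k assume g: "g \<in> carrier G" and k: "k \<in> S_class S g"
    have "g \<in> S_class S k" using S_class(2)[OF g] S_class_eq[OF S_class(1)[OF g] k] by simp
    then have "k \<in> N \<longleftrightarrow> g \<in> N" using S_normalD[OF N] k by blast
    then show "F k = F g" by (simp add: F_def)
  qed
  obtain c where c: "\<And>g. g \<in> carrier G \<Longrightarrow> F g = (\<Sum>X\<in>fst S. c X * \<sigma> X g)"
    and p: "\<And>X \<chi>. X \<in> fst S \<Longrightarrow> \<chi> \<in> X \<Longrightarrow> pairing F \<chi> = c X * \<chi> \<one> * of_nat (card (carrier G))"
    by (rule superclass_expansion[OF F]) blast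
  have "c X * \<sigma> X h = c X * \<sigma> X \<one>" if X: "X \<in> fst S" for X
  proof (cases "c X = 0")
    case False
    have "N \<subseteq> char_ker G (\<sigma> X)"
    proof (rule sigma_char_kerI[OF X])
      fix \<chi> assume \<chi>X: "\<chi> \<in> X"
      have \<chi>: "\<chi> \<in> Irr G" using part_subset_Irr[OF X] \<chi>X by blast
      have "(\<Sum>h\<in>N. \<chi> h) = (\<Sum>h\<in>N. \<chi> (inv h))"
        by (rule sum.reindex_bij_witness[where i = "\<lambda>h. inv h" and j = "\<lambda>h. inv h"])
          (use NG subgroup.m_inv_closed[OF sub] in auto)
      also have "\<dots> = (\<Sum>g\<in>carrier G. F g * \<chi> (inv g))"
        using NG by (intro sum.mono_neutral_cong_left) (auto simp: F_def)
      also have "\<dots> \<noteq> 0"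
        using p[OF X \<chi>X] False Irr_one_neq_0[OF \<chi>] carrier_not_empty by (simp add: pairing_def)
      finally show "N \<subseteq> char_ker G \<chi>"
        using Irr_normal_sum[OF \<chi> S_normal_imp_normal[OF N]] by blast
    qed
    then show ?thesis using no[OF X] by (simp add: char_ker_def)
  qed simp
  then have "(\<Sum>X\<in>fst S. c X * \<sigma> X h) = (\<Sum>X\<in>fst S. c X * \<sigma> X \<one>)"
    by (intro sum.cong) auto
  then have "F h = F \<one>" using h by (simp add: c)
  then show False using h subgroup.one_closed[OF sub] by (simp add: F_def)
qed

text \<open>A representation that is trivial on \<open>[G,S]\<close> is constant on \<open>S\<close>-classes.  For its character, the coefficient
formula leaves no room for a second member of \<open>X\<close>; for the representation, it means
that conjugates have the same image, so that the image is commutative and consists of scalars.\<close>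

lemma sigma_nonvanishing:
  assumes X: "X \<in> fst S" and ker: "S_commutator G S \<subseteq> char_ker G (\<sigma> X)" and g: "g \<in> carrier G"
  shows "\<sigma> X g \<noteq> 0"
proof -
  obtain \<chi> where \<chi>X: "\<chi> \<in> X" using part_nonempty[OF X] by blast
  have \<chi>I: "\<chi> \<in> Irr G" using part_subset_Irr[OF X] \<chi>X by blast
  then obtain \<rho> n where irr: "irreducible_rep G n \<rho>" and \<chi>: "\<chi> = character_of G \<rho>" by (rule IrrE)
  have nrm: "S_commutator G S \<lhd> G" by (rule S_normal_imp_normal[OF S_commutator_S_normal])
  have triv: "\<rho> m = 1\<^sub>m n" if "m \<in> S_commutator G S" for m
    using normal_in_char_ker_rep[OF irr nrm _ that] normal_in_sigma_char_ker[OF X nrm ker \<chi>X] \<chi> by blast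
  have const: "\<rho> k = \<rho> x" if x: "x \<in> carrier G" and k: "k \<in> S_class S x" for x k
  proof -
    have kG: "k \<in> carrier G" using k S_class_subset[OF x] by blast
    have "\<rho> k = \<rho> (x \<otimes> (inv x \<otimes> k))" using x kG by (simp add: m_assoc[symmetric])
    also have "\<dots> = \<rho> x * \<rho> (inv x \<otimes> k)" using x kG by (simp add: rep_mult[OF irr])
    also have "\<dots> = \<rho> x" using triv[OF S_commutator_mem[OF x k]] rep_carrier[OF irr x] by simp
    finally show ?thesis .
  qed
  have "superclass_fun \<chi>"
  proof (rule superclass_funI)
    fix x k assume x: "x \<in> carrier G" and k: "k \<in> S_class S x"
    have "k \<in> carrier G" using k S_class_subset[OF x] by blast
    then show "\<chi> k = \<chi> x" using x const[OF x k] by (simp add: \<chi> character_of_def)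
  qed
  then obtain c where c: "\<And>\<psi>. \<psi> \<in> X \<Longrightarrow> pairing \<chi> \<psi> = c X * \<psi> \<one> * of_nat (card (carrier G))"
    using superclass_expansion X by metis
  have cG: "of_nat (card (carrier G)) \<noteq> (0::complex)" using carrier_not_empty by simp
  have cX: "c X \<noteq> 0" using c[OF \<chi>X] irreducible_characters_orthogonal[OF \<chi>I \<chi>I] cG by auto
  have "\<psi> = \<chi>" if \<psi>X: "\<psi> \<in> X" for \<psi>
  proof (rule ccontr)
    assume ne: "\<psi> \<noteq> \<chi>"
    have \<psi>I: "\<psi> \<in> Irr G" using part_subset_Irr[OF X] \<psi>X by blast
    show False
      using c[OF \<psi>X] irreducible_characters_orthogonal[OF \<chi>I \<psi>I] ne cX Irr_one_neq_0[OF \<psi>I] cG by simp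
  qed
  then have X1: "X = {\<chi>}" using \<chi>X by blast
  have "\<rho> (x \<otimes> g) = \<rho> (g \<otimes> x)" if x: "x \<in> carrier G" for x
  proof -
    have "\<rho> (x \<otimes> g) = \<rho> (x \<otimes> g \<otimes> inv x \<otimes> x)" using g x by (simp add: m_assoc)
    also have "\<dots> = \<rho> (x \<otimes> g \<otimes> inv x) * \<rho> x" using g x by (simp add: rep_mult[OF irr])
    also have "\<dots> = \<rho> (g \<otimes> x)" using const[OF g conj_in_S_class[OF g x]] g x by (simp add: rep_mult[OF irr])
    finally show ?thesis .
  qed
  then obtain l where "l \<noteq> 0" "\<And>x. x \<in> carrier G \<Longrightarrow> \<chi> (g \<otimes> x) = l * \<chi> x"
    using commuting_element_scalar[OF irr g] \<chi> by metis
  then have "\<chi> g = l * \<chi> \<one>" "l \<noteq> 0" using g by (metis one_closed r_one)+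
  then show ?thesis using g Irr_one_neq_0[OF \<chi>I] by (simp add: sigma_apply X1)
qed

section \<open>The subgroups V and U\<close>

text \<open>Because \<open>Z(S)\<close> is a subgroup, it contains \<open>V(S | N)\<close> as soon as it contains the generators.\<close>

lemma V_over_subset_center_iff:
  "V_over G S N \<subseteq> S_center G S \<longleftrightarrow>
    (\<forall>\<chi>\<in>S_irr_over G S N. \<forall>g\<in>carrier G - S_center G S. \<chi> g = 0)"
proof -
  let ?A = "{g \<in> carrier G. \<exists>\<chi>\<in>S_irr_over G S N. \<chi> g \<noteq> 0}"
  have "generate G ?A \<subseteq> S_center G S \<longleftrightarrow> ?A \<subseteq> S_center G S"
    using generate_subgroup_incl[OF _ subgroup_S_center, of ?A] generate.incl[of _ ?A G] by blast
  then show ?thesis unfolding V_over_def by auto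
qed

text \<open>Pick \<open>g\<close> outside \<open>Z(S)\<close> and another element \<open>k\<close> of its \<open>S\<close>-class.  Then \<open>g\<^sup>-\<^sup>1 k \<noteq> 1\<close> lies in \<open>[G,S]\<close>, and some
\<open>\<sigma>\<^sub>X\<close> separates it from \<open>1\<close>.  This \<open>\<sigma>\<^sub>X\<close> lies over \<open>[G,S]\<close> and is non-zero at every point of \<open>Z(S)\<close>.\<close>

lemma center_subset_V:
  assumes "\<not> S_abelian G S"
  shows "S_center G S \<subseteq> V_S G S"
proof
  fix z assume z: "z \<in> S_center G S"
  have zG: "z \<in> carrier G" using z by (simp add: S_center_iff)
  obtain g where g: "g \<in> carrier G" "g \<notin> S_center G S"
    using assms by (auto simp: S_abelian_def S_center_def)
  then obtain k where k: "k \<in> S_class S g" "k \<noteq> g"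
    using S_class(2)[OF g(1)] by (auto simp: S_center_iff)
  have kG: "k \<in> carrier G" using k S_class_subset[OF g(1)] by blast
  let ?h = "inv g \<otimes> k"
  have h: "?h \<in> S_commutator G S" by (rule S_commutator_mem[OF g(1) k(1)])
  have h1: "?h \<noteq> \<one>" using k(2) g(1) kG by (metis inv_equality inv_inv inv_closed)
  have "S_normal G S {\<one>}" using S_class_one by (intro S_normalI triv_subgroup) auto
  then obtain X where X: "X \<in> fst S" "?h \<notin> char_ker G (\<sigma> X)"
    using S_normal_separation[of "{\<one>}" ?h] g(1) kG h1 by auto
  obtain c where c: "c \<noteq> 0" "\<sigma> X (z \<otimes> \<one>) = inverse c * \<sigma> X \<one>"
    using sigma_translate_center[OF z X(1)] by (metis one_closed)
  have "\<sigma> X z \<noteq> 0" using c sigma_one_neq_0[OF X(1)] zG by simp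
  moreover have "\<sigma> X \<in> S_irr_over G S (S_commutator G S)"
    using X h by (auto simp: S_irr_over_def S_irr_def)
  ultimately show "z \<in> V_S G S"
    unfolding V_S_def V_over_def using zG by (intro generate.incl) blast
qed

lemma VZ_iff:
  assumes "\<not> S_abelian G S"
  shows "VZ_group G S \<longleftrightarrow> S_center G S = V_S G S"
  using center_subset_V[OF assms] V_over_subset_center_iff[of "S_commutator G S"]
  by (auto simp: VZ_group_def V_S_def)

lemma set_mult_memI: "x \<in> H \<Longrightarrow> y \<in> K \<Longrightarrow> x \<otimes> y \<in> H <#> K"
  by (auto simp: set_mult_def)

lemma one_in_foldr_set_mult:
  assumes "\<And>H. H \<in> set Hs \<Longrightarrow> subgroup H G"
  shows "\<one> \<in> foldr (set_mult G) Hs {\<one>}"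
  using assms
proof (induction Hs)
  case (Cons K Hs)
  then have "\<one> \<in> K" "\<one> \<in> foldr (set_mult G) Hs {\<one>}" by (auto intro: subgroup.one_closed)
  from set_mult_memI[OF this] show ?case by simp
qed simp

lemma subset_foldr_set_mult:
  assumes "\<And>H. H \<in> set Hs \<Longrightarrow> subgroup H G" "H \<in> set Hs"
  shows "H \<subseteq> foldr (set_mult G) Hs {\<one>}"
  using assms
proof (induction Hs)
  case (Cons K Hs)
  have K1: "\<one> \<in> K" using Cons.prems(1)[of K] by (simp add: subgroup.one_closed)
  have Hs1: "\<one> \<in> foldr (set_mult G) Hs {\<one>}"
    using Cons.prems(1) by (intro one_in_foldr_set_mult) simp
  show ?case
  proof
    fix x assume x: "x \<in> H"
    have xG: "x \<in> carrier G" using Cons.prems x by (meson subgroup.mem_carrier)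
    show "x \<in> foldr (set_mult G) (K # Hs) {\<one>}"
    proof (cases "H = K")
      case True
      then show ?thesis using set_mult_memI[OF _ Hs1, of x K] x xG by simp
    next
      case False
      then have "x \<in> foldr (set_mult G) Hs {\<one>}" using Cons x by auto
      then show ?thesis using set_mult_memI[OF K1, of x] xG by simp
    qed
  qed
qed simp

lemma foldr_set_mult_subset:
  assumes "subgroup K G" "\<And>H. H \<in> set Hs \<Longrightarrow> H \<subseteq> K"
  shows "foldr (set_mult G) Hs {\<one>} \<subseteq> K"
  using assms(2)
proof (induction Hs)
  case Nil
  then show ?case using subgroup.one_closed[OF assms(1)] by simp
next
  case (Cons H Hs)
  then have "H \<subseteq> K" "foldr (set_mult G) Hs {\<one>} \<subseteq> K" by auto
  then have "H <#> foldr (set_mult G) Hs {\<one>} \<subseteq> K"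
    using subgroup.m_closed[OF assms(1)] by (fastforce simp: set_mult_def)
  then show ?case by simp
qed

lemma subgroups_product_subset:
  assumes "subgroup K G" "\<And>H. H \<in> \<H> \<Longrightarrow> H \<subseteq> K"
  shows "subgroups_product G \<H> \<subseteq> K"
  using foldr_set_mult_subset[OF assms(1)] assms(2) unfolding subgroups_product_def by blast

lemma subset_subgroups_product:
  assumes "\<And>H. H \<in> \<H> \<Longrightarrow> subgroup H G" "H \<in> \<H>"
  shows "H \<subseteq> subgroups_product G \<H>"
proof -
  have "\<H> \<subseteq> Pow (carrier G)" using assms(1) subgroup.subset by blast
  then have "finite \<H>" using finite_subset by blast
  then obtain Hs where "set Hs = \<H>" "distinct Hs" using finite_distinct_list by blast
  then show ?thesis using subset_foldr_set_mult[of Hs H] assms unfolding subgroups_product_def by blast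
qed

text \<open>For each \<open>\<chi> \<in> X\<close>, all the factors lie in the kernel of the underlying representation, which is visibly a
subgroup.\<close>

lemma char_ker_subgroups_product:
  assumes X: "X \<in> fst S" and nrm: "\<And>H. H \<in> \<H> \<Longrightarrow> H \<lhd> G"
    and ker: "\<And>H. H \<in> \<H> \<Longrightarrow> H \<subseteq> char_ker G (\<sigma> X)"
  shows "subgroups_product G \<H> \<subseteq> char_ker G (\<sigma> X)"
proof (rule sigma_char_kerI[OF X])
  fix \<chi> assume \<chi>X: "\<chi> \<in> X"
  then have "\<chi> \<in> Irr G" using part_subset_Irr[OF X] by blast
  then obtain \<rho> n where irr: "irreducible_rep G n \<rho>" and \<chi>: "\<chi> = character_of G \<rho>" by (rule IrrE)
  let ?K = "{g \<in> carrier G. \<rho> g = 1\<^sub>m n}"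
  have "subgroup ?K G"
  proof (rule subgroupI)
    show "?K \<noteq> {}" using rep_one[OF irr] by blast
    show "inv g \<in> ?K" if "g \<in> ?K" for g
      using that rep_r_inv[OF irr, of g] rep_carrier[OF irr, of "inv g"] by simp
    show "g \<otimes> h \<in> ?K" if "g \<in> ?K" "h \<in> ?K" for g h
      using that by (simp add: rep_mult[OF irr])
  qed auto
  moreover have "H \<subseteq> ?K" if H: "H \<in> \<H>" for H
    using normal_in_char_ker_rep[OF irr nrm[OF H]] normal_in_sigma_char_ker[OF X nrm[OF H] ker[OF H] \<chi>X]
      normal_imp_subgroup[OF nrm[OF H]] subgroup.subset \<chi> by blast
  ultimately have "subgroups_product G \<H> \<subseteq> ?K" by (rule subgroups_product_subset)
  also have "?K \<subseteq> char_ker G \<chi>"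
    using rep_one[OF irr] by (auto simp: char_ker_def \<chi> character_of_def)
  finally show "subgroups_product G \<H> \<subseteq> char_ker G \<chi>" .
qed

text \<open>A factor \<open>H\<close> of \<open>U(S)\<close> not contained in \<open>[G,S]\<close> would have a nowhere vanishing \<open>\<sigma>\<^sub>X\<close> over it, so
that \<open>Z(S)\<close> would be all of \<open>G\<close>.\<close>

lemma U_subset_commutator:
  assumes "\<not> S_abelian G S"
  shows "U_S G S \<subseteq> S_commutator G S"
  unfolding U_S_def U_over_def
proof (rule subgroups_product_subset)
  show "subgroup (S_commutator G S) G" using S_commutator_S_normal by (simp add: S_normal_def)
  fix H assume "H \<in> {H. S_normal G S H \<and> V_over G S H \<subseteq> S_center G S}"
  then have H: "S_normal G S H" and V: "V_over G S H \<subseteq> S_center G S" by auto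
  show "H \<subseteq> S_commutator G S"
  proof (rule ccontr)
    assume "\<not> H \<subseteq> S_commutator G S"
    then obtain h where h: "h \<in> H" "h \<notin> S_commutator G S" by blast
    then have "h \<in> carrier G" using H subgroup.mem_carrier by (fastforce simp: S_normal_def)
    then obtain X where X: "X \<in> fst S" "S_commutator G S \<subseteq> char_ker G (\<sigma> X)" "h \<notin> char_ker G (\<sigma> X)"
      using S_normal_separation[OF S_commutator_S_normal _ h(2)] by metis
    have "\<sigma> X \<in> S_irr_over G S H" using X h by (auto simp: S_irr_over_def S_irr_def)
    then have "carrier G - S_center G S = {}"
      using V sigma_nonvanishing[OF X(1,2)] unfolding V_over_subset_center_iff by blast
    then show False using assms by (auto simp: S_abelian_def S_center_def)
  qed
qed

text \<open>From left to right, \<open>[G,S]\<close> becomes a factor of \<open>U(S)\<close>.  From right to left, an \<open>S\<close>-character over the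
product of the factors is over one of them, and therefore vanishes off \<open>Z(S)\<close>.\<close>

lemma V_subset_center_iff_U:
  assumes "\<not> S_abelian G S"
  shows "V_S G S \<subseteq> S_center G S \<longleftrightarrow> U_S G S = S_commutator G S"
proof -
  let ?\<H> = "{H. S_normal G S H \<and> V_over G S H \<subseteq> S_center G S}"
  have sub: "subgroup H G" if "H \<in> ?\<H>" for H using that by (simp add: S_normal_def)
  show ?thesis
  proof
    assume "V_S G S \<subseteq> S_center G S"
    then have "S_commutator G S \<in> ?\<H>" using S_commutator_S_normal by (simp add: V_S_def)
    then have "S_commutator G S \<subseteq> U_S G S"
      unfolding U_S_def U_over_def using subset_subgroups_product sub by blast
    then show "U_S G S = S_commutator G S" using U_subset_commutator[OF assms] by blast
  next
    assume U: "U_S G S = S_commutator G S"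
    show "V_S G S \<subseteq> S_center G S"
      unfolding V_S_def V_over_subset_center_iff
    proof (intro ballI)
      fix \<chi> g assume \<chi>: "\<chi> \<in> S_irr_over G S (S_commutator G S)" and g: "g \<in> carrier G - S_center G S"
      obtain X where X: "X \<in> fst S" "\<chi> = \<sigma> X" "\<not> S_commutator G S \<subseteq> char_ker G (\<sigma> X)"
        using \<chi> by (auto simp: S_irr_over_def S_irr_def)
      obtain H where H: "H \<in> ?\<H>" "\<not> H \<subseteq> char_ker G (\<sigma> X)"
        using X(3) char_ker_subgroups_product[OF X(1), of ?\<H>] S_normal_imp_normal
        unfolding U[symmetric] U_S_def U_over_def by blast
      then have "\<chi> \<in> S_irr_over G S H" using X by (auto simp: S_irr_over_def S_irr_def)
      then show "\<chi> g = 0" using H(1) g unfolding V_over_subset_center_iff by blast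
    qed
  qed
qed

end

theorem theorem1p4:
  fixes G :: "('a, 'b) monoid_scheme" and S :: "'a sct"
  assumes "group G"
    and "finite (carrier G)"
    and "supercharacter_theory G S"
    and "\<not> S_abelian G S"
  shows "(VZ_group G S \<longleftrightarrow> S_center G S = V_S G S) \<and>
         (S_center G S = V_S G S \<longleftrightarrow> U_S G S = S_commutator G S)"
proof -
  interpret supercharacters G S
    using assms by (intro supercharacters.intro finite_group.intro finite_group_axioms.intro supercharacters_axioms.intro)
  show ?thesis
    using VZ_iff[OF assms(4)] V_subset_center_iff_U[OF assms(4)] center_subset_V[OF assms(4)] by blast
qed

end
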